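(* Let $\alpha,\beta,\gamma,\delta\in\mathbb C$ satisfy $\bar\alpha\gamma\in\mathbb R$, $\bar\beta\delta\in\mathbb R$ and $\beta\bar\gamma-\bar\alpha\delta=1$. Assume that $L_{\alpha,\beta}$ is self-adjoint and let $\lambda\in\rho(L_{\alpha,\beta})\cap\rho(L)$. Assume also that $1\in\rho(G_\lambda^{\alpha,\beta}I^* )\cap\rho(G_{\bar\lambda}^{\alpha,\beta}I^* )$ and that, for $\mu\in\{\lambda,\bar\lambda\}$, the operator $I\,T_\mu^{\alpha,\beta}I^*$ is relatively bounded with respect to $(\mathrm{Id}-G_{\bar\mu}^{\alpha,\beta}I^* )^*(L_{\alpha,\beta}-\mu)(\mathrm{Id}-G_\mu^{\alpha,\beta}I^* )$ with bound $a<1$. Then $H_{\mathrm{IBC}}^{\alpha,\beta}$ is self-adjoint. Moreover, with $\Gamma_\mu^{\alpha,\beta}:=R(1,G_\mu^{\alpha,\beta}I^* )=(\mathrm{Id}-G_\mu^{\alpha,\beta}I^* )^{-1}$ for $\mu\in\{\lambda,\bar\lambda\}$, we have $$\lambda\in\rho(L_{\alpha,\beta})\cap\rho(H_{\mathrm{IBC}}^{\alpha,\beta})\iff 1\in\rho\Big((\Gamma_{\bar\lambda}^{\alpha,\beta})^*\,I\,T_\lambda^{\alpha,\beta}I^*\,\Gamma_\lambda^{\alpha,\beta}R(\lambda,L_{\alpha,\beta})\Big),$$ and the resolvent is then given by $$R(\lambda,H_{\mathrm{IBC}}^{\alpha,\beta})=\Gamma_\lambda^{\alpha,\beta}R(\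lambda,L_{\alpha,\beta})\Big(1-(\Gamma_{\bar\lambda}^{\alpha,\beta})^*\,I\,T_\lambda^{\alpha,\beta}I^*\,\Gamma_\lambda^{\alpha,\beta}R(\lambda,L_{\alpha,\beta})\Big)^{-1}(\Gamma_{\bar\lambda}^{\alpha,\beta})^*.$$
   Context: **General conventions.** For a densely defined operator $S$, $\rho(S)$ is the set of $z\in\mathbb C$ such that $z-S:D(S)\to$ (whole space) is bijective with bounded inverse, and $R(z,S):=(z-S)^{-1}$. Products of operators have their natural domain $D(ST)=\{x\in D(T): Tx\in D(S)\}$. An operator $S$ is relatively bounded with respect to an operator $R$ with bound $a$ if $D(R)\subset D(S)$ and there is $b\ge 0$ with $\|Sf\|\le a\|Rf\|+b\|f\|$ for all $f\in D(R)$. **Setting.** $\mathscr H$ and $\partial\mathscr H$ are complex Hilbert spaces; $L_m:D(L_m)\subset\mathscr H\to\mathscr H$ is a densely defined linear operator; $B:D(L_m)\to\partial\mathscr H$ and $A_m:D(A_m)\subset\mathscr H\to\partial\mathscr H$ are linear operators; $I:\partial\mathscr H\to\mathscr H$ is a bounded linear operator. Put $L:=L_m|_{\ker B}$ (so $D(L)=\ker B$) and $A:=A_m|_{\ker B}$. Standing assumptions: (a) $L$ is self-adjoint; (b) $A$ is relatively $L$-bounded (in particular $D(L)\subset D(A_m)$); (c) for $\lambda\in\rho(L)$, $\mathrm{rg}\big((AR(\lambda,L))^*\big)\subseteq\ker(\bar\lambda-L_m)$; (d) for $\lambda\in\rho(L)$, $B(AR(\lambda,L))^*=\mathrm{Id}_{\partial\mathscr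 H}$. For $\lambda\in\rho(L)$ define $G_\lambda:=(AR(\bar\lambda,L))^*\in\mathcal L(\partial\mathscr H,\mathscr H)$ and $T_\lambda:=A_mG_\lambda$ with $D(T_\lambda)=\{\varphi\in\partial\mathscr H: G_\lambda\varphi\in D(A_m)\}$; this domain does not depend on $\lambda$ and is denoted $D(T)$. Further standing assumption: $T_\lambda$ is densely defined and $T_{\bar\lambda}\subset T_\lambda^*$ for all $\lambda\in\rho(L)$. **Operators.** $H_{\mathrm{IBC}}^{\alpha,\beta}f:=L_mf+\gamma IA_mf+\delta IBf$ with $D(H_{\mathrm{IBC}}^{\alpha,\beta}):=\{f\in D(L_m)\cap D(A_m):\alpha A_mf+\beta Bf=I^*f\}$ (the dependence on $\gamma,\delta$ is suppressed). $L_{\alpha,\beta}f:=L_mf$ with $D(L_{\alpha,\beta}):=\{f\in D(L_m)\cap D(A_m):\alpha A_mf+\beta Bf=0\}$. For $\lambda\in\rho(L)$ with $\bar\lambda\in\rho(L_{\alpha,\beta})$, $G_\lambda^{\alpha,\beta}$ is the restriction of $\big((\gamma A_m+\delta B)R(\bar\lambda,L_{\alpha,\beta})\big)^*$ to $D(G_\lambda^{\alpha,\beta}):=\mathrm{rg}(\alpha T_{\bar\lambda}^*+\beta)$, where for $\alpha=0$ the operator $\alpha T_{\bar\lambda}^*+\beta$ is understood as $\beta\,\mathrm{Id}_{\partial\mathscr H}$. Moreover $T_\lambda^{\alpha,\beta}:=(\gamma A_m+\delta B)G_\lambda^{\alpha,\beta}$ on $D(T_\lambda^{\alpha,\beta}):=\{\varphi\in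 D(G_\lambda^{\alpha,\beta}):G_\lambda^{\alpha,\beta}\varphi\in D(L_m)\cap D(A_m)\}$. *)

theory Defs
  imports "HOL-Analysis.Analysis"
begin

section \<open>Complex Hilbert spaces\<close>

text \<open>The norm is tied to the inner product, so that \<^class>\<open>banach\<close> supplies topology and
  completeness. The inner product is antilinear in its first argument; adjoints do not depend
  on this choice.\<close>

class chilbert_space = banach +
  fixes scaleC :: "complex \<Rightarrow> 'a \<Rightarrow> 'a" (infixr "*\<^sub>C" 75)
    and cinner :: "'a \<Rightarrow> 'a \<Rightarrow> complex"
  assumes scaleC_add_right: "c *\<^sub>C (x + y) = c *\<^sub>C x + c *\<^sub>C y"
    and scaleC_add_left: "(c + d) *\<^sub>C x = c *\<^sub>C x + d *\<^sub>C x"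
    and scaleC_scaleC: "c *\<^sub>C d *\<^sub>C x = (c * d) *\<^sub>C x"
    and scaleR_scaleC: "r *\<^sub>R x = complex_of_real r *\<^sub>C x"
    and cinner_commute: "cinner x y = cnj (cinner y x)"
    and cinner_add_right: "cinner x (y + z) = cinner x y + cinner x z"
    and cinner_scaleC_right: "cinner x (c *\<^sub>C y) = c * cinner x y"
    and norm_eq_sqrt_cinner: "norm x = sqrt (Re (cinner x x))"

instantiation complex :: chilbert_space
begin

definition scaleC_complex_def: "scaleC c x = c * (x :: complex)"
definition cinner_complex_def: "cinner x y = cnj x * (y :: complex)"

instance
  by standard (auto simp: scaleC_complex_def cinner_complex_def algebra_simps scaleR_conv_of_real
      cmod_def power2_eq_square)

end

section \<open>Unbounded operators\<close>

text \<open>An operator \<open>S : D(S) \<subseteq> X \<rightarrow> Y\<close> is the partial function with \<^term>\<open>dom S\<close> \<open>= D(S)\<close>.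
  Then equality of operators includes equality of domains, \<^term>\<open>S \<circ>\<^sub>m T\<close> is the product on its
  natural domain, \<^term>\<open>S |` D\<close> the restriction, \<^term>\<open>S \<subseteq>\<^sub>m T\<close> the inclusion of operators, and
  \<^const>\<open>Some\<close> the identity.\<close>

definition op_linear :: "('a::chilbert_space \<rightharpoonup> 'b::chilbert_space) \<Rightarrow> bool" where
  "op_linear S \<longleftrightarrow> S 0 = Some 0 \<and>
     (\<forall>x y u v. S x = Some u \<longrightarrow> S y = Some v \<longrightarrow> S (x + y) = Some (u + v)) \<and>
     (\<forall>c x u. S x = Some u \<longrightarrow> S (c *\<^sub>C x) = Some (c *\<^sub>C u))"

definition op_bounded :: "('a::chilbert_space \<rightharpoonup> 'b::chilbert_space) \<Rightarrow> bool" where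
  "op_bounded S \<longleftrightarrow> (\<exists>K. \<forall>x\<in>dom S. norm (the (S x)) \<le> K * norm x)"

definition densely_defined :: "('a::chilbert_space \<rightharpoonup> 'b::chilbert_space) \<Rightarrow> bool" where
  "densely_defined S \<longleftrightarrow> closure (dom S) = UNIV"

definition op_ker :: "('a::chilbert_space \<rightharpoonup> 'b::chilbert_space) \<Rightarrow> 'a set" where
  "op_ker S = {x. S x = Some 0}"

definition op_add :: "('a::chilbert_space \<rightharpoonup> 'b::chilbert_space) \<Rightarrow> ('a \<rightharpoonup> 'b) \<Rightarrow> ('a \<rightharpoonup> 'b)"
    (infixl "+\<^sub>o" 65) where
  "S +\<^sub>o T = (\<lambda>x. if x \<in> dom S \<inter> dom T then Some (the (S x) + the (T x)) else None)"

definition op_diff :: "('a::chilbert_space \<rightharpoonup> 'b::chilbert_space) \<Rightarrow> ('a \<rightharpoonup> 'b) \<Rightarrow> ('a \<rightharpoonup> 'b)"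
    (infixl "-\<^sub>o" 65) where
  "S -\<^sub>o T = (\<lambda>x. if x \<in> dom S \<inter> dom T then Some (the (S x) - the (T x)) else None)"

text \<open>Scaling keeps the domain, also for the scalar \<open>0\<close>.\<close>

definition op_scale :: "complex \<Rightarrow> ('a::chilbert_space \<rightharpoonup> 'b::chilbert_space) \<Rightarrow> ('a \<rightharpoonup> 'b)"
    (infixr "*\<^sub>o" 75) where
  "c *\<^sub>o S = (\<lambda>x. map_option (\<lambda>y. c *\<^sub>C y) (S x))"

text \<open>The inverse, with domain \<^term>\<open>ran S\<close>, of an injective operator.\<close>

definition op_inv :: "('a::chilbert_space \<rightharpoonup> 'b::chilbert_space) \<Rightarrow> ('b \<rightharpoonup> 'a)" where
  "op_inv S = (\<lambda>y. if y \<in> ran S then Some (THE x. S x = Some y) else None)"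

text \<open>The adjoint is meaningful for densely defined \<open>S\<close> only, when the vector \<open>z\<close> is unique.\<close>

definition adj :: "('a::chilbert_space \<rightharpoonup> 'b::chilbert_space) \<Rightarrow> ('b \<rightharpoonup> 'a)" where
  "adj S = (\<lambda>y. if \<exists>z. \<forall>x\<in>dom S. cinner (the (S x)) y = cinner x z
     then Some (THE z. \<forall>x\<in>dom S. cinner (the (S x)) y = cinner x z) else None)"

definition self_adjoint :: "('a::chilbert_space \<rightharpoonup> 'a) \<Rightarrow> bool" where
  "self_adjoint S \<longleftrightarrow> op_linear S \<and> densely_defined S \<and> adj S = S"

definition rel_bounded ::
    "real \<Rightarrow> ('a::chilbert_space \<rightharpoonup> 'b::chilbert_space) \<Rightarrow> ('a \<rightharpoonup> 'c::chilbert_space) \<Rightarrow> bool" where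
  "rel_bounded a S R \<longleftrightarrow> dom R \<subseteq> dom S \<and>
     (\<exists>b\<ge>0. \<forall>f\<in>dom R. norm (the (S f)) \<le> a * norm (the (R f)) + b * norm f)"

definition resolvent :: "complex \<Rightarrow> ('a::chilbert_space \<rightharpoonup> 'a) \<Rightarrow> ('a \<rightharpoonup> 'a)" where
  "resolvent z S = op_inv (z *\<^sub>o Some -\<^sub>o S)"

text \<open>The resolvent set is a notion for densely defined operators, so \<open>z \<in> \<rho>(S)\<close> includes density
  of the domain.\<close>

definition resolvent_set :: "('a::chilbert_space \<rightharpoonup> 'a) \<Rightarrow> complex set" ("\<rho>") where
  "\<rho> S = {z. densely_defined S \<and>
     bij_betw (\<lambda>x. the ((z *\<^sub>o Some -\<^sub>o S) x)) (dom (z *\<^sub>o Some -\<^sub>o S)) UNIV \<and>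
     op_bounded (resolvent z S)}"

section \<open>The abstract boundary setting\<close>

definition L_op :: "('h::chilbert_space \<rightharpoonup> 'h) \<Rightarrow> ('h \<rightharpoonup> 'b::chilbert_space) \<Rightarrow> ('h \<rightharpoonup> 'h)" where
  "L_op Lm B = Lm |` op_ker B"

definition A_op :: "('h::chilbert_space \<rightharpoonup> 'b::chilbert_space) \<Rightarrow> ('h \<rightharpoonup> 'b) \<Rightarrow> ('h \<rightharpoonup> 'b)" where
  "A_op Am B = Am |` op_ker B"

definition G_op :: "('h::chilbert_space \<rightharpoonup> 'h) \<Rightarrow> ('h \<rightharpoonup> 'b::chilbert_space) \<Rightarrow> ('h \<rightharpoonup> 'b) \<Rightarrow>
    complex \<Rightarrow> ('b \<rightharpoonup> 'h)" where
  "G_op Lm Am B z = adj (A_op Am B \<circ>\<^sub>m resolvent (cnj z) (L_op Lm B))"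

definition T_op :: "('h::chilbert_space \<rightharpoonup> 'h) \<Rightarrow> ('h \<rightharpoonup> 'b::chilbert_space) \<Rightarrow> ('h \<rightharpoonup> 'b) \<Rightarrow>
    complex \<Rightarrow> ('b \<rightharpoonup> 'b)" where
  "T_op Lm Am B z = Am \<circ>\<^sub>m G_op Lm Am B z"

locale ibc_setting =
  fixes Lm :: "'h::chilbert_space \<rightharpoonup> 'h"
    and Am :: "'h \<rightharpoonup> 'b::chilbert_space"
    and B :: "'h \<rightharpoonup> 'b"
    and I :: "'b \<rightharpoonup> 'h"
  assumes Lm_linear: "op_linear Lm"
    and Lm_dense: "densely_defined Lm"
    and B_linear: "op_linear B"
    and B_dom: "dom B = dom Lm"
    and Am_linear: "op_linear Am"
    and I_linear: "op_linear I"
    and I_dom: "dom I = UNIV"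
    and I_bounded: "op_bounded I"
    and L_self_adjoint: "self_adjoint (L_op Lm B)"
    and A_rel_bounded: "\<exists>a. rel_bounded a (A_op Am B) (L_op Lm B)"
    and ran_adj_AR: "\<And>z. z \<in> \<rho> (L_op Lm B) \<Longrightarrow>
      ran (adj (A_op Am B \<circ>\<^sub>m resolvent z (L_op Lm B))) \<subseteq> op_ker (cnj z *\<^sub>o Some -\<^sub>o Lm)"
    and B_adj_AR: "\<And>z. z \<in> \<rho> (L_op Lm B) \<Longrightarrow>
      B \<circ>\<^sub>m adj (A_op Am B \<circ>\<^sub>m resolvent z (L_op Lm B)) = Some"
    and T_dense: "\<And>z. z \<in> \<rho> (L_op Lm B) \<Longrightarrow> densely_defined (T_op Lm Am B z)"
    and T_adj: "\<And>z. z \<in> \<rho> (L_op Lm B) \<Longrightarrow>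
      T_op Lm Am B (cnj z) \<subseteq>\<^sub>m adj (T_op Lm Am B z)"

section \<open>Interior-boundary conditions\<close>

definition H_IBC :: "('h::chilbert_space \<rightharpoonup> 'h) \<Rightarrow> ('h \<rightharpoonup> 'b::chilbert_space) \<Rightarrow> ('h \<rightharpoonup> 'b) \<Rightarrow>
    ('b \<rightharpoonup> 'h) \<Rightarrow> complex \<Rightarrow> complex \<Rightarrow> complex \<Rightarrow> complex \<Rightarrow> ('h \<rightharpoonup> 'h)" where
  "H_IBC Lm Am B I \<alpha> \<beta> \<gamma> \<delta> =
     (Lm +\<^sub>o \<gamma> *\<^sub>o (I \<circ>\<^sub>m Am) +\<^sub>o \<delta> *\<^sub>o (I \<circ>\<^sub>m B)) |`
       {f \<in> dom Lm \<inter> dom Am. \<alpha> *\<^sub>C the (Am f) + \<beta> *\<^sub>C the (B f) = the (adj I f)}"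

definition L_ab :: "('h::chilbert_space \<rightharpoonup> 'h) \<Rightarrow> ('h \<rightharpoonup> 'b::chilbert_space) \<Rightarrow> ('h \<rightharpoonup> 'b) \<Rightarrow>
    complex \<Rightarrow> complex \<Rightarrow> ('h \<rightharpoonup> 'h)" where
  "L_ab Lm Am B \<alpha> \<beta> =
     Lm |` {f \<in> dom Lm \<inter> dom Am. \<alpha> *\<^sub>C the (Am f) + \<beta> *\<^sub>C the (B f) = 0}"

text \<open>The operator \<open>\<alpha> T\<^sup>* + \<beta>\<close>, read as \<open>\<beta> Id\<close> on the whole space if \<open>\<alpha> = 0\<close>.\<close>

definition aTb :: "complex \<Rightarrow> complex \<Rightarrow> ('b::chilbert_space \<rightharpoonup> 'b) \<Rightarrow> ('b \<rightharpoonup> 'b)" where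
  "aTb \<alpha> \<beta> T = (if \<alpha> = 0 then \<beta> *\<^sub>o Some else \<alpha> *\<^sub>o adj T +\<^sub>o \<beta> *\<^sub>o Some)"

text \<open>In the setting of interest the adjoint below is defined on all of the range to which it is
  restricted.\<close>

definition G_ab :: "('h::chilbert_space \<rightharpoonup> 'h) \<Rightarrow> ('h \<rightharpoonup> 'b::chilbert_space) \<Rightarrow> ('h \<rightharpoonup> 'b) \<Rightarrow>
    complex \<Rightarrow> complex \<Rightarrow> complex \<Rightarrow> complex \<Rightarrow> complex \<Rightarrow> ('b \<rightharpoonup> 'h)" where
  "G_ab Lm Am B \<alpha> \<beta> \<gamma> \<delta> z =
     adj ((\<gamma> *\<^sub>o Am +\<^sub>o \<delta> *\<^sub>o B) \<circ>\<^sub>m resolvent (cnj z) (L_ab Lm Am B \<alpha> \<beta>)) |`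
       ran (aTb \<alpha> \<beta> (T_op Lm Am B (cnj z)))"

definition T_ab :: "('h::chilbert_space \<rightharpoonup> 'h) \<Rightarrow> ('h \<rightharpoonup> 'b::chilbert_space) \<Rightarrow> ('h \<rightharpoonup> 'b) \<Rightarrow>
    complex \<Rightarrow> complex \<Rightarrow> complex \<Rightarrow> complex \<Rightarrow> complex \<Rightarrow> ('b \<rightharpoonup> 'b)" where
  "T_ab Lm Am B \<alpha> \<beta> \<gamma> \<delta> z =
     ((\<gamma> *\<^sub>o Am +\<^sub>o \<delta> *\<^sub>o B) \<circ>\<^sub>m G_ab Lm Am B \<alpha> \<beta> \<gamma> \<delta> z) |`
       {\<phi> \<in> dom (G_ab Lm Am B \<alpha> \<beta> \<gamma> \<delta> z).
          the (G_ab Lm Am B \<alpha> \<beta> \<gamma> \<delta> z \<phi>) \<in> dom Lm \<inter> dom Am}"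

end

theory Submission
  imports Defs
begin

text \<open>Write \<open>P = \<alpha> A\<^sub>m + \<beta> B\<close> and \<open>Q = \<gamma> A\<^sub>m + \<delta> B\<close>. The conditions on the coefficients turn Green's
  identity for \<open>(B, A\<^sub>m)\<close> into the same identity for \<open>(P, Q)\<close>, so \<open>H\<close> is symmetric.
  Every \<open>f\<close> in the domain decomposes as \<open>f = h + G P f\<close> with \<open>P h = 0\<close>, where \<open>G\<close> is the operator
  \<open>G\<^sup>\<alpha>\<^sup>\<beta>\<close> at \<open>\<mu>\<close>. Since \<open>P f = I\<^sup>* f\<close> on the domain of \<open>H\<close>, this gives \<open>H - \<mu> = S + V\<close>, where
  \<open>S = (1 - G' I\<^sup>*)\<^sup>* (L - \<mu>) (1 - G I\<^sup>*)\<close> (with \<open>G'\<close> taken at the conjugate of \<open>\<mu>\<close>) has a bounded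
  inverse and \<open>V = I T I\<^sup>*\<close> is a relatively bounded perturbation. The adjoint of \<open>S\<close> is the same expression
  at the conjugate of \<open>\<mu>\<close>, and a Kato--Rellich argument for the block operator with entries \<open>S\<close>
  and \<open>S\<^sup>*\<close> shows that \<open>H\<close> is self-adjoint. The resolvent formula is read off from the
  factorization of \<open>\<mu> - H\<close>.\<close>

section \<open>Complex Hilbert spaces\<close>

lemma scaleC_one [simp]: "1 *\<^sub>C (x::'a::chilbert_space) = x"
  using scaleR_scaleC[of 1 x] by simp

lemma scaleC_zero_left [simp]: "0 *\<^sub>C (x::'a::chilbert_space) = 0"
  using scaleR_scaleC[of 0 x] by simp

lemma scaleC_minus_one: "(-1) *\<^sub>C (x::'a::chilbert_space) = - x"
  using scaleR_scaleC[of "-1" x] by simp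

lemma scaleC_zero_right [simp]: "c *\<^sub>C (0::'a::chilbert_space) = 0"
  using scaleC_add_right[of c 0 "0::'a"] by simp

lemma scaleC_minus_right [simp]: "c *\<^sub>C (- x) = - (c *\<^sub>C (x::'a::chilbert_space))"
  using scaleC_add_right[of c "-x" x] by (simp add: eq_neg_iff_add_eq_0)

lemma scaleC_minus_left [simp]: "(- c) *\<^sub>C (x::'a::chilbert_space) = - (c *\<^sub>C x)"
  using scaleC_add_left[of "-c" c x] by (simp add: eq_neg_iff_add_eq_0)

lemma scaleC_diff_right: "c *\<^sub>C (x - y) = c *\<^sub>C x - c *\<^sub>C (y::'a::chilbert_space)"
  using scaleC_add_right[of c x "-y"] by simp

lemma scaleC_diff_left: "(c - d) *\<^sub>C x = c *\<^sub>C x - d *\<^sub>C (x::'a::chilbert_space)"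
  using scaleC_add_left[of c "-d" x] by simp

lemmas scaleC_simps = scaleC_add_right scaleC_add_left scaleC_diff_right scaleC_diff_left
  scaleC_scaleC

lemma cinner_add_left: "cinner (x + y) z = cinner x z + cinner (y::'a::chilbert_space) z"
  by (metis cinner_add_right cinner_commute complex_cnj_add)

lemma cinner_scaleC_left: "cinner (c *\<^sub>C x) y = cnj c * cinner (x::'a::chilbert_space) y"
  by (metis cinner_commute cinner_scaleC_right complex_cnj_mult)

lemma cinner_minus_right [simp]: "cinner x (- y) = - cinner (x::'a::chilbert_space) y"
  using cinner_scaleC_right[of x "-1" y] by (simp add: scaleC_minus_one)

lemma cinner_minus_left [simp]: "cinner (- x) y = - cinner (x::'a::chilbert_space) y"
  using cinner_scaleC_left[of "-1" x y] by (simp add: scaleC_minus_one)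

lemma cinner_diff_right: "cinner x (y - z) = cinner x y - cinner (x::'a::chilbert_space) z"
  using cinner_add_right[of x y "-z"] by simp

lemma cinner_diff_left: "cinner (x - y) z = cinner x z - cinner (y::'a::chilbert_space) z"
  using cinner_add_left[of x "-y" z] by simp

lemma cinner_zero_right [simp]: "cinner x (0::'a::chilbert_space) = 0"
  using cinner_scaleC_right[of x 0 0] by simp

lemma cinner_zero_left [simp]: "cinner (0::'a::chilbert_space) x = 0"
  using cinner_scaleC_left[of 0 0 x] by simp

lemmas cinner_simps = cinner_add_left cinner_add_right cinner_diff_left cinner_diff_right
  cinner_scaleC_left cinner_scaleC_right

lemma cinner_self: "cinner x x = complex_of_real ((norm (x::'a::chilbert_space))\<^sup>2)"
proof -
  have "Im (cinner x x) = 0"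
    using cinner_commute[of x x] by (metis Reals_cnj_iff complex_is_Real_iff)
  moreover have "0 \<le> Re (cinner x x)"
    using norm_eq_sqrt_cinner[of x] norm_ge_zero[of x] by (metis real_sqrt_ge_0_iff)
  ultimately show ?thesis
    using norm_eq_sqrt_cinner[of x] by (simp add: complex_eq_iff)
qed

lemma norm_square_eq_cinner: "(norm (x::'a::chilbert_space))\<^sup>2 = Re (cinner x x)"
  by (simp add: cinner_self)

lemma norm_square_add:
  "(norm (x + y))\<^sup>2 = (norm x)\<^sup>2 + (norm y)\<^sup>2 + 2 * Re (cinner x (y::'a::chilbert_space))"
proof -
  have "Re (cinner y x) = Re (cinner x y)"
    by (metis cinner_commute complex_cnj(1) complex_surj complex.sel(1))
  then show ?thesis
    by (simp add: norm_square_eq_cinner cinner_simps)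
qed

lemma norm_scaleC [simp]: "norm (c *\<^sub>C x) = cmod c * norm (x::'a::chilbert_space)"
proof -
  have "cinner (c *\<^sub>C x) (c *\<^sub>C x) = (cnj c * c) * cinner x x"
    by (simp add: cinner_simps)
  also have "\<dots> = complex_of_real ((cmod c * norm x)\<^sup>2)"
    by (simp add: cinner_self power_mult_distrib complex_norm_square[symmetric] mult.commute[of "cnj c"])
  finally have "(norm (c *\<^sub>C x))\<^sup>2 = (cmod c * norm x)\<^sup>2"
    unfolding cinner_self of_real_eq_iff .
  then show ?thesis
    by (simp add: power2_eq_iff_nonneg)
qed

lemma cinner_Cauchy_Schwarz: "cmod (cinner x y) \<le> norm x * norm (y::'a::chilbert_space)"
proof (cases "y = 0")
  case False
  \<comment> \<open>This \<open>c\<close> minimizes the norm of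
    \<open>x + c *\<^sub>C y\<close>.\<close>
  define c where "c = - cnj (cinner x y) / complex_of_real ((norm y)\<^sup>2)"
  have "0 \<le> (norm (x + c *\<^sub>C y))\<^sup>2" by simp
  also have "\<dots> = (norm x)\<^sup>2 + (cmod c * norm y)\<^sup>2 + 2 * Re (c * cinner x y)"
    by (simp add: norm_square_add cinner_simps)
  also have "c * cinner x y = complex_of_real (- (cmod (cinner x y))\<^sup>2 / (norm y)\<^sup>2)"
    by (simp add: c_def complex_norm_square[symmetric] mult.commute[of "cnj (cinner x y)"])
  also have "cmod c = cmod (cinner x y) / (norm y)\<^sup>2"
    by (simp add: c_def norm_divide norm_power)
  finally have "(cmod (cinner x y))\<^sup>2 \<le> (norm x * norm y)\<^sup>2"
    using False by (simp add: field_simps power2_eq_square)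
  then show ?thesis
    by (rule power2_le_imp_le) simp
qed simp

lemma bounded_bilinear_cinner: "bounded_bilinear (cinner :: 'a::chilbert_space \<Rightarrow> _)"
proof
  show "\<exists>K. \<forall>a b. norm (cinner a (b::'a)) \<le> norm a * norm b * K"
    using cinner_Cauchy_Schwarz by (intro exI[of _ 1]) auto
qed (auto simp: cinner_simps scaleR_scaleC scaleC_complex_def)

lemma continuous_on_cinner_left: "continuous_on A (\<lambda>u. cinner u (w::'a::chilbert_space))"
  by (intro bounded_bilinear.continuous_on[OF bounded_bilinear_cinner] continuous_intros)

lemma continuous_on_cinner_right: "continuous_on A (\<lambda>u. cinner (w::'a::chilbert_space) u)"
  by (intro bounded_bilinear.continuous_on[OF bounded_bilinear_cinner] continuous_intros)

text \<open>The bound passes from \<open>D\<close> to its closure by continuity, and then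
  \<open>u = w\<close> may be inserted. This is how norms and equalities are tested on a dense set
  below.\<close>

lemma norm_le_of_cinner_bound:
  fixes w :: "'a::chilbert_space"
  assumes "closure D = UNIV" and "0 \<le> C" and "\<And>u. u \<in> D \<Longrightarrow> cmod (cinner u w) \<le> C * norm u"
  shows "norm w \<le> C"
proof -
  have "closed {u. cmod (cinner u w) \<le> C * norm u}"
    by (intro closed_Collect_le continuous_intros continuous_on_cinner_left)
  then have "closure D \<subseteq> {u. cmod (cinner u w) \<le> C * norm u}"
    using assms(3) by (intro closure_minimal) auto
  then have "cmod (cinner w w) \<le> C * norm w"
    using assms(1) by auto
  then show ?thesis
    using \<open>0 \<le> C\<close> by (cases "w = 0") (auto simp: cinner_self norm_mult power2_eq_square)
qed

lemma cinner_eqI_dense: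
  fixes y w :: "'a::chilbert_space"
  assumes "closure D = UNIV" and "\<And>u. u \<in> D \<Longrightarrow> cinner u y = cinner u w"
  shows "y = w"
  using norm_le_of_cinner_bound[OF assms(1), of 0 "y - w"] assms(2)
  by (simp add: cinner_diff_right)

lemma cinner_eqI: "(\<And>u. cinner u y = cinner u w) \<Longrightarrow> y = (w::'a::chilbert_space)"
  by (rule cinner_eqI_dense[of UNIV]) auto

section \<open>Everywhere defined linear and bounded maps\<close>

definition clinear :: "('a::chilbert_space \<Rightarrow> 'b::chilbert_space) \<Rightarrow> bool" where
  "clinear f \<longleftrightarrow> (\<forall>x y. f (x + y) = f x + f y) \<and> (\<forall>c x. f (c *\<^sub>C x) = c *\<^sub>C f x)"

definition cbounded :: "('a::chilbert_space \<Rightarrow> 'b::chilbert_space) \<Rightarrow> bool" where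
  "cbounded f \<longleftrightarrow> (\<exists>K\<ge>0. \<forall>x. norm (f x) \<le> K * norm x)"

lemma clinear_add: "clinear f \<Longrightarrow> f (x + y) = f x + f y"
  and clinear_scaleC: "clinear f \<Longrightarrow> f (c *\<^sub>C x) = c *\<^sub>C f x"
  by (auto simp: clinear_def)

lemma clinear_imp_linear: "clinear f \<Longrightarrow> linear f"
  by (auto simp: clinear_def scaleR_scaleC intro!: linearI)

lemma clinear_diff: "clinear f \<Longrightarrow> f (x - y) = f x - f y"
  and clinear_minus: "clinear f \<Longrightarrow> f (- x) = - f x"
  by (auto dest!: clinear_imp_linear simp: linear_diff linear_neg)

lemma clinear_compose: "clinear f \<Longrightarrow> clinear g \<Longrightarrow> clinear (\<lambda>x. f (g x))"
  by (auto simp: clinear_def)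

lemma clinear_uminus: "clinear f \<Longrightarrow> clinear (\<lambda>x. - f x)"
  by (auto simp: clinear_def)

lemma cboundedI: "(\<And>x. norm (f x) \<le> K * norm x) \<Longrightarrow> cbounded f"
  unfolding cbounded_def
  by (rule exI[of _ "\<bar>K\<bar>"]) (auto intro!: order_trans[OF _ mult_right_mono[OF abs_ge_self]])

lemma cboundedE:
  assumes "cbounded f" obtains K where "0 \<le> K" "\<And>x. norm (f x) \<le> K * norm x"
  using assms by (auto simp: cbounded_def)

lemma cbounded_compose:
  assumes "cbounded f" "cbounded g" shows "cbounded (\<lambda>x. f (g x))"
proof -
  obtain K M where K: "0 \<le> K" "\<And>x. norm (f x) \<le> K * norm x"
    and M: "0 \<le> M" "\<And>x. norm (g x) \<le> M * norm x"
    using assms by (metis cboundedE)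
  have "norm (f (g x)) \<le> (K * M) * norm x" for x
    using K(2)[of "g x"] mult_left_mono[OF M(2) K(1), of x] by simp
  then show ?thesis by (rule cboundedI)
qed

lemma cbounded_uminus: "cbounded f \<Longrightarrow> cbounded (\<lambda>x. - f x)"
  by (auto simp: cbounded_def)

section \<open>Riesz representation and uniform boundedness\<close>

text \<open>The representing vector minimizes \<open>\<parallel>x\<parallel>\<^sup>2 - 2 Re (f x)\<close>; by the parallelogram law
  minimizing sequences are Cauchy.\<close>

theorem Riesz_representation:
  fixes f :: "'a::chilbert_space \<Rightarrow> complex"
  assumes lin: "clinear f" and bdd: "cbounded f"
  obtains w where "\<And>x. f x = cinner w x"
proof -
  obtain K where K: "0 \<le> K" "\<And>x. cmod (f x) \<le> K * norm x"
    using cboundedE[OF bdd] by blast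
  have fR: "f (r *\<^sub>R x) = complex_of_real r * f x" for r x
    using clinear_scaleC[OF lin, of "complex_of_real r"] by (simp add: scaleR_scaleC scaleC_complex_def)
  have "bounded_linear f"
    using K(2) clinear_imp_linear[OF lin]
    by (auto simp: linear_conv_bounded_linear[symmetric] mult.commute bounded_linear_def
        bounded_linear_axioms_def intro!: exI[of _ K])
  then have contf: "continuous_on UNIV f"
    by (rule linear_continuous_on)
  define J where "J x = (norm x)\<^sup>2 - 2 * Re (f x)" for x
  define m where "m = Inf (range J)"
  have J_lower: "- K\<^sup>2 \<le> J x" for x
  proof -
    have "Re (f x) \<le> K * norm x"
      using K(2)[of x] complex_Re_le_cmod[of "f x"] by linarith
    moreover have "0 \<le> (norm x - K)\<^sup>2" by simp
    ultimately show ?thesis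
      by (simp add: J_def power2_diff) (simp add: algebra_simps)
  qed
  have bdd: "bdd_below (range J)"
    unfolding bdd_below_def using J_lower by blast
  have m_le: "m \<le> J x" for x
    unfolding m_def by (rule cINF_lower[OF bdd]) simp
  have "\<exists>x. J x < m + 1 / real (Suc n)" for n
  proof -
    have "Inf (range J) < m + 1 / real (Suc n)"
      by (simp add: m_def)
    then show ?thesis
      using bdd by (subst (asm) cInf_less_iff) auto
  qed
  then obtain X where X: "\<And>n. J (X n) < m + 1 / real (Suc n)"
    by metis
  have par: "(norm (x - y))\<^sup>2 \<le> 2 * (J x - m) + 2 * (J y - m)" for x y
  proof -
    have n: "norm ((1/2) *\<^sub>R (x + y)) = norm (x + y) / 2"
      by (simp only: norm_scaleR)
    have r: "Re (f ((1/2) *\<^sub>R (x + y))) = (Re (f x) + Re (f y)) / 2"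
      unfolding fR clinear_add[OF lin] by simp
    have mid: "J ((1/2) *\<^sub>R (x + y)) = (norm (x + y))\<^sup>2 / 4 - (Re (f x) + Re (f y))"
      unfolding J_def n r by (simp add: power_divide field_simps)
    have "(norm (x - y))\<^sup>2 = (norm x)\<^sup>2 + (norm y)\<^sup>2 - 2 * Re (cinner x y)"
      using norm_square_add[of x "- y"] by simp
    moreover have "m \<le> (norm (x + y))\<^sup>2 / 4 - (Re (f x) + Re (f y))"
      using m_le[of "(1/2) *\<^sub>R (x + y)"] unfolding mid .
    ultimately show ?thesis
      using norm_square_add[of x y]
      unfolding J_def[of x] J_def[of y] by argo
  qed
  have "Cauchy X"
  proof (rule metric_CauchyI)
    fix e :: real assume "0 < e"
    then obtain N where N: "inverse (real (Suc N)) < e\<^sup>2 / 4"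
      using reals_Archimedean[of "e\<^sup>2 / 4"] by auto
    have small: "J (X n) - m < e\<^sup>2 / 4" if "N \<le> n" for n
    proof -
      have "1 / real (Suc n) \<le> inverse (real (Suc N))"
        using that by (simp add: field_simps)
      then show ?thesis
        using X[of n] N by linarith
    qed
    have "dist (X p) (X q) < e" if "N \<le> p" "N \<le> q" for p q
    proof -
      have "(norm (X p - X q))\<^sup>2 < e\<^sup>2"
        using par[of "X p" "X q"] small[OF that(1)] small[OF that(2)] by argo
      then show ?thesis
        using \<open>0 < e\<close> by (simp add: dist_norm power2_less_imp_less)
    qed
    then show "\<exists>M. \<forall>p\<ge>M. \<forall>q\<ge>M. dist (X p) (X q) < e"
      by blast
  qed
  then obtain w where w: "X \<longlonglongrightarrow> w"
    using Cauchy_convergent convergent_def by blast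
  have "continuous_on UNIV J"
    unfolding J_def by (intro continuous_intros contf)
  then have "(\<lambda>n. J (X n)) \<longlonglongrightarrow> J w"
    using w by (simp add: continuous_on_tendsto_compose)
  moreover have "(\<lambda>n. m + 1 / real (Suc n)) \<longlonglongrightarrow> m + 0"
    by (intro tendsto_intros LIMSEQ_Suc[OF lim_1_over_n])
  ultimately have "J w \<le> m"
    using X by (intro LIMSEQ_le[of _ "J w" _ m]) (auto intro: less_imp_le)
  then have min: "J w \<le> J x" for x
    using m_le[of x] by linarith
  have Re_eq: "Re (f y) = Re (cinner w y)" for y
  proof (rule ccontr)
    define d where "d = Re (cinner w y) - Re (f y)"
    \<comment> \<open>Nearly the minimizer of
      \<open>t\<^sup>2 * (norm y)\<^sup>2 + 2 * t * d\<close>; the added 1 keeps the denominator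
      positive for \<open>y = 0\<close> too.\<close>
    define t where "t = - d / ((norm y)\<^sup>2 + 1)"
    assume "Re (f y) \<noteq> Re (cinner w y)"
    then have "d \<noteq> 0" by (simp add: d_def)
    have pos: "0 < (norm y)\<^sup>2 + 1"
      by (simp add: add_nonneg_pos)
    have "cinner w (t *\<^sub>R y) = complex_of_real t * cinner w y"
      by (simp add: scaleR_scaleC cinner_simps)
    then have "J (w + t *\<^sub>R y) = J w + t\<^sup>2 * (norm y)\<^sup>2 + 2 * t * d"
      by (simp add: J_def norm_square_add fR clinear_add[OF lin] d_def power_mult_distrib
          algebra_simps)
    then have "0 \<le> t\<^sup>2 * (norm y)\<^sup>2 + 2 * t * d"
      using min[of "w + t *\<^sub>R y"] by simp
    also have "\<dots> \<le> t\<^sup>2 * ((norm y)\<^sup>2 + 1) + 2 * t * d"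
      by (simp add: algebra_simps)
    also have "\<dots> = t * (t * ((norm y)\<^sup>2 + 1) + 2 * d)"
      by (simp add: algebra_simps power2_eq_square)
    also have "t * ((norm y)\<^sup>2 + 1) = - d"
      using pos by (simp add: t_def)
    also have "t * (- d + 2 * d) = - (d\<^sup>2 / ((norm y)\<^sup>2 + 1))"
      by (simp add: t_def power2_eq_square)
    finally show False
      using \<open>d \<noteq> 0\<close> pos by (auto simp: divide_le_0_iff dest: not_le_imp_less)
  qed
  \<comment> \<open>Real parts at \<open>\<i> *\<^sub>C y\<close> are, up to sign, the imaginary
    parts at \<open>y\<close>.\<close>
  have "f y = cinner w y" for y
    using Re_eq[of y] Re_eq[of "\<i> *\<^sub>C y"]
    by (simp add: complex_eq_iff clinear_scaleC[OF lin] scaleC_complex_def cinner_simps)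
  then show ?thesis by (rule that)
qed

text \<open>For fixed \<open>y\<close> the functional \<open>\<lambda>x. cinner y (f x)\<close> is
  linear and bounded, so Riesz representation yields the value of the adjoint at
  \<open>y\<close>.\<close>

lemma bounded_adjoint:
  fixes f :: "'a::chilbert_space \<Rightarrow> 'b::chilbert_space"
  assumes "clinear f" "cbounded f"
  obtains g where "clinear g" "cbounded g" "\<And>x y. cinner (f x) y = cinner x (g y)"
proof -
  obtain K where K: "0 \<le> K" "\<And>x. norm (f x) \<le> K * norm x"
    using cboundedE[OF assms(2)] by blast
  have "\<exists>w. \<forall>x. cinner y (f x) = cinner w x" for y
  proof -
    have "clinear (\<lambda>x. cinner y (f x))"
      using assms(1) by (auto simp: clinear_def cinner_simps scaleC_complex_def)
    moreover have "cmod (cinner y (f x)) \<le> (norm y * K) * norm x" for x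
      using cinner_Cauchy_Schwarz[of y "f x"] mult_left_mono[OF K(2), of "norm y" x] by simp
    then have "cbounded (\<lambda>x. cinner y (f x))"
      by (rule cboundedI)
    ultimately show ?thesis
      by (metis Riesz_representation)
  qed
  then obtain g where "\<And>x y. cinner y (f x) = cinner (g y) x"
    by metis
  then have g: "cinner (f x) y = cinner x (g y)" for x y
    by (metis cinner_commute)
  have "norm (g y) \<le> K * norm y" for y
  proof (rule norm_le_of_cinner_bound[of UNIV])
    fix x
    show "cmod (cinner x (g y)) \<le> (K * norm y) * norm x"
      using cinner_Cauchy_Schwarz[of "f x" y] mult_right_mono[OF K(2), of "norm y" x]
      by (simp add: g algebra_simps)
  qed (use K in auto)
  then have "cbounded g" by (rule cboundedI)
  moreover have "clinear g"
    unfolding clinear_def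
    by (intro conjI allI; rule cinner_eqI) (simp_all add: cinner_simps g[symmetric])
  ultimately show ?thesis
    using g that by blast
qed

text \<open>For fixed \<open>y\<close>, \<open>cinner (X u) y\<close> equals
  \<open>cinner u (f y)\<close> and so is at most a multiple of \<open>norm u\<close>. The sets
  \<open>F n\<close> of those \<open>y\<close> for which the factor \<open>n\<close> suffices are
  closed and cover the space, so by Baire's theorem one of them contains a ball. Density of
  \<open>D\<close> turns this uniform bound into a bound for \<open>f\<close>.\<close>

theorem Hellinger_Toeplitz_dense:
  fixes f :: "'a::chilbert_space \<Rightarrow> 'b::chilbert_space" and X :: "'b \<Rightarrow> 'a"
  assumes dense: "closure D = UNIV"
    and adj: "\<And>u y. u \<in> D \<Longrightarrow> cinner (X u) y = cinner u (f y)"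
  shows "cbounded f"
proof -
  define F where "F n = {y. \<forall>u\<in>D. cmod (cinner (X u) y) \<le> real n * norm u}" for n
  have closed_F: "closed (F n)" for n
  proof -
    have "F n = (\<Inter>u\<in>D. {y. cmod (cinner (X u) y) \<le> real n * norm u})"
      by (auto simp: F_def)
    then show ?thesis
      by (auto intro!: closed_Collect_le continuous_intros continuous_on_cinner_right)
  qed
  have "y \<in> F (nat \<lceil>norm (f y)\<rceil>)" for y
  proof -
    have "cmod (cinner (X u) y) \<le> real (nat \<lceil>norm (f y)\<rceil>) * norm u" if "u \<in> D" for u
    proof -
      have "cmod (cinner (X u) y) \<le> norm (f y) * norm u"
        using cinner_Cauchy_Schwarz[of u "f y"] adj[OF that] by (simp add: mult.commute)
      also have "\<dots> \<le> real (nat \<lceil>norm (f y)\<rceil>) * norm u"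
        by (intro mult_right_mono real_nat_ceiling_ge) auto
      finally show ?thesis .
    qed
    then show ?thesis by (simp add: F_def)
  qed
  then have "(\<Union>n. F n) = UNIV"
    by blast
  have "\<exists>n. interior (F n) \<noteq> {}"
  proof (rule ccontr)
    assume "\<nexists>n. interior (F n) \<noteq> {}"
    then have "interior (\<Union>(range F)) = {}"
      using Met_TC.metric_Baire_category_alt[where 'a='a, of "range F"] closed_F
      by (auto simp: complete_UNIV)
    then show False
      using \<open>(\<Union>n. F n) = UNIV\<close> by simp
  qed
  then obtain n y0 where "y0 \<in> interior (F n)"
    by blast
  then obtain e where e: "0 < e" "cball y0 e \<subseteq> F n"
    by (meson mem_interior_cball)
  have le: "norm (f y) \<le> 2 * real n" if "norm y \<le> e" for y
  proof (rule norm_le_of_cinner_bound[OF dense])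
    fix u assume u: "u \<in> D"
    \<comment> \<open>\<open>y\<close> is the difference of two points of the ball, which costs the
      factor 2.\<close>
    have "y0 \<in> F n" "y0 + y \<in> F n"
      using e that by (auto simp: dist_norm)
    then have "cmod (cinner (X u) (y0 + y)) + cmod (cinner (X u) y0) \<le> 2 * real n * norm u"
      using u by (auto simp: F_def dest!: bspec[of _ _ u])
    then show "cmod (cinner u (f y)) \<le> 2 * real n * norm u"
      using norm_triangle_ineq4[of "cinner (X u) (y0 + y)" "cinner (X u) y0"]
      by (simp add: adj[OF u] cinner_add_right)
  qed simp
  have scale: "f (r *\<^sub>R y) = r *\<^sub>R f y" for r y
    by (rule cinner_eqI_dense[OF dense]) (simp add: adj[symmetric] scaleR_scaleC cinner_simps)
  have "norm (f y) \<le> (2 * real n / e) * norm y" for y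
  proof (cases "y = 0")
    case True
    then show ?thesis using scale[of 0 y] by simp
  next
    case False
    then show ?thesis
      using le[of "(e / norm y) *\<^sub>R y"] e(1) by (simp add: scale field_simps)
  qed
  then show ?thesis by (rule cboundedI)
qed

section \<open>Perturbation of surjective maps\<close>

text \<open>With \<open>q = M w\<close> the equation becomes the fixed point problem
  \<open>q = p - N (inv M q)\<close>. The right inverse need not be linear: only \<open>M\<close> of
  a difference of its values enters the contraction estimate.\<close>

lemma surj_perturbation:
  fixes M N :: "'a::banach \<Rightarrow> 'b::banach"
  assumes "linear M" "linear N" "surj M" "k < 1"
    and bound: "\<And>w. norm (N w) \<le> k * norm (M w)"
  shows "surj (\<lambda>w. M w + N w)"
proof -
  have "\<exists>w. p = M w + N w" for p
  proof -
    define \<Phi> where "\<Phi> w = p - N (inv M w)" for w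
    \<comment> \<open>\<open>k\<close> may be negative, whereas a contraction constant must not
      be.\<close>
    define k' where "k' = max 0 k"
    have "\<exists>!w. \<Phi> w = w"
    proof (rule banach_fix_type)
      show "\<forall>u v. dist (\<Phi> u) (\<Phi> v) \<le> k' * dist u v"
      proof (intro allI)
        fix u v
        have "dist (\<Phi> u) (\<Phi> v) = norm (N (inv M u - inv M v))"
          by (simp add: \<Phi>_def dist_norm linear_diff[OF \<open>linear N\<close>] norm_minus_commute)
        also have "\<dots> \<le> k * norm (M (inv M u - inv M v))"
          by (rule bound)
        also have "\<dots> = k * dist u v"
          by (simp add: linear_diff[OF \<open>linear M\<close>] surj_f_inv_f[OF \<open>surj M\<close>] dist_norm)
        also have "\<dots> \<le> k' * dist u v"
          by (intro mult_right_mono) (auto simp: k'_def)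
        finally show "dist (\<Phi> u) (\<Phi> v) \<le> k' * dist u v" .
      qed
    qed (use \<open>k < 1\<close> in \<open>auto simp: k'_def\<close>)
    then obtain w where "\<Phi> w = w" by blast
    then have "p = w + N (inv M w)"
      unfolding \<Phi>_def by (simp only: diff_eq_eq)
    then have "p = M (inv M w) + N (inv M w)"
      by (simp only: surj_f_inv_f[OF \<open>surj M\<close>])
    then show ?thesis by blast
  qed
  then show ?thesis unfolding surj_def by blast
qed

text \<open>Continuation in \<open>c\<close>: the lower bound allows to increase \<open>c\<close> by a factor \<open>3/2\<close>.\<close>

lemma surj_continuation:
  fixes J :: "'a::banach \<Rightarrow> 'a"
  assumes "bounded_linear J"
    and bound: "\<And>c w. 0 \<le> c \<Longrightarrow> norm w \<le> norm (w + c *\<^sub>R J w) \<and> c * norm (J w) \<le> norm (w + c *\<^sub>R J w)"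
  shows "\<exists>c>C. surj (\<lambda>w. w + c *\<^sub>R J w)"
proof -
  interpret J: bounded_linear J by fact
  obtain K where K: "0 < K" "\<And>w. norm (J w) \<le> norm w * K"
    using J.pos_bounded by blast
  \<comment> \<open>The initial value \<open>1 / (2 * K)\<close> makes
    \<open>c 0 *\<^sub>R J\<close> a perturbation of the identity of relative size at most
    1/2.\<close>
  define c where "c n = (1 / (2 * K)) * (3/2) ^ n" for n :: nat
  have lin: "linear (\<lambda>w. r *\<^sub>R J w)" "linear (\<lambda>w. w + r *\<^sub>R J w)" for r
    by (auto intro!: linearI simp: J.add J.scaleR algebra_simps)
  have pos: "0 < c n" for n
    using K(1) by (simp add: c_def)
  have surj: "surj (\<lambda>w. w + c n *\<^sub>R J w)" for n
  proof (induction n)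
    case 0
    show ?case
    proof (rule surj_perturbation[where k = "1/2"])
      show "norm (c 0 *\<^sub>R J w) \<le> 1/2 * norm w" for w
        using K(2)[of w] K(1) by (simp add: c_def field_simps)
    qed (auto intro!: lin linear_id[unfolded id_def])
  next
    case (Suc n)
    have "surj (\<lambda>w. (w + c n *\<^sub>R J w) + (c n / 2) *\<^sub>R J w)"
    proof (rule surj_perturbation[where k = "1/2"])
      show "norm ((c n / 2) *\<^sub>R J w) \<le> 1/2 * norm (w + c n *\<^sub>R J w)" for w
        using bound[of "c n" w] pos[of n] by simp
    qed (use Suc lin in auto)
    moreover have "w + c (Suc n) *\<^sub>R J w = (w + c n *\<^sub>R J w) + (c n / 2) *\<^sub>R J w" for w
      by (simp add: c_def scaleR_add_left[symmetric] add.assoc)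
    ultimately show ?case by presburger
  qed
  obtain n where "C * (2 * K) < (3/2) ^ n"
    using real_arch_pow[of "3/2" "C * (2 * K)"] by auto
  then have "C < c n"
    using K(1) by (simp add: c_def field_simps)
  then show ?thesis
    using surj by blast
qed

section \<open>Unbounded operators\<close>

lemma op_linear_0: "op_linear S \<Longrightarrow> S 0 = Some 0"
  and op_linear_add: "op_linear S \<Longrightarrow> S x = Some u \<Longrightarrow> S y = Some v \<Longrightarrow> S (x + y) = Some (u + v)"
  and op_linear_scaleC: "op_linear S \<Longrightarrow> S x = Some u \<Longrightarrow> S (c *\<^sub>C x) = Some (c *\<^sub>C u)"
  by (auto simp: op_linear_def)

lemma op_linear_diff:
  assumes "op_linear S" "S x = Some u" "S y = Some v"
  shows "S (x - y) = Some (u - v)"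
  using op_linear_add[OF assms(1,2) op_linear_scaleC[OF assms(1,3), of "-1"]]
  by (simp add: scaleC_minus_one)

lemma op_linear_minus: "op_linear S \<Longrightarrow> S x = Some u \<Longrightarrow> S (- x) = Some (- u)"
  using op_linear_scaleC[of S x u "-1"] by (simp add: scaleC_minus_one)

lemma op_linear_total: "op_linear (\<lambda>x. Some (f x)) \<longleftrightarrow> clinear f"
  unfolding op_linear_def clinear_def
  by (auto, metis scaleC_zero_left)

lemma total_op:
  assumes "op_linear S" "dom S = UNIV" "op_bounded S"
  obtains f where "S = (\<lambda>x. Some (f x))" "clinear f" "cbounded f"
proof -
  have S: "S = (\<lambda>x. Some (the (S x)))"
    using assms(2) by (intro ext) (metis UNIV_I domD option.sel)
  moreover have "clinear (\<lambda>x. the (S x))"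
    using assms(1) S by (metis op_linear_total)
  moreover have "cbounded (\<lambda>x. the (S x))"
    using assms(2,3) by (auto simp: op_bounded_def intro: cboundedI)
  ultimately show ?thesis by (rule that)
qed

lemma op_linear_comp:
  assumes "op_linear S" "op_linear T" shows "op_linear (S \<circ>\<^sub>m T)"
  unfolding op_linear_def map_comp_Some_iff
  using op_linear_0[OF assms(1)] op_linear_0[OF assms(2)] op_linear_add[OF assms(1)]
    op_linear_add[OF assms(2)] op_linear_scaleC[OF assms(1)] op_linear_scaleC[OF assms(2)]
  by meson

lemma op_linear_restrict:
  assumes "op_linear S" "0 \<in> A" "\<And>x y. x \<in> A \<Longrightarrow> y \<in> A \<Longrightarrow> x + y \<in> A"
    "\<And>c x. x \<in> A \<Longrightarrow> c *\<^sub>C x \<in> A"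
  shows "op_linear (S |` A)"
  using assms by (auto simp: op_linear_def restrict_map_def split: if_splits)

lemma op_linear_restrict_ran:
  assumes S: "op_linear S" and T: "op_linear T"
  shows "op_linear (S |` ran T)"
  by (rule op_linear_restrict[OF S])
    (auto simp: ran_def intro: op_linear_0[OF T] op_linear_add[OF T] op_linear_scaleC[OF T])

lemma op_add_Some_iff: "(S +\<^sub>o T) x = Some y \<longleftrightarrow> (\<exists>u v. S x = Some u \<and> T x = Some v \<and> y = u + v)"
  by (auto simp: op_add_def)

lemma op_diff_Some_iff: "(S -\<^sub>o T) x = Some y \<longleftrightarrow> (\<exists>u v. S x = Some u \<and> T x = Some v \<and> y = u - v)"
  by (auto simp: op_diff_def)

lemma op_scale_Some_iff: "(c *\<^sub>o S) x = Some y \<longleftrightarrow> (\<exists>u. S x = Some u \<and> y = c *\<^sub>C u)"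
  by (auto simp: op_scale_def)

lemma op_linear_op_add: "op_linear S \<Longrightarrow> op_linear T \<Longrightarrow> op_linear (S +\<^sub>o T)"
  by (auto simp: op_linear_def op_add_Some_iff scaleC_add_right add_ac)

lemma op_linear_op_scale: "op_linear S \<Longrightarrow> op_linear (c *\<^sub>o S)"
  by (auto simp: op_linear_def op_scale_Some_iff scaleC_add_right scaleC_scaleC mult.commute)

lemma op_linear_Some: "op_linear Some"
  by (auto simp: op_linear_def)

section \<open>Adjoints of densely defined operators\<close>

lemma densely_definedD: "densely_defined S \<Longrightarrow> closure (dom S) = UNIV"
  by (simp add: densely_defined_def)

text \<open>Density makes the representing vector unique, which resolves the definite description in
  \<open>adj\<close>.\<close>

lemma adj_SomeI:
  assumes dense: "densely_defined S"
    and w: "\<And>x u. S x = Some u \<Longrightarrow> cinner u y = cinner x w"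
  shows "adj S y = Some w"
proof -
  have *: "\<forall>x\<in>dom S. cinner (the (S x)) y = cinner x w"
    using w by auto
  moreover have "v = w" if "\<forall>x\<in>dom S. cinner (the (S x)) y = cinner x v" for v
    using that * by (intro cinner_eqI_dense[OF densely_definedD[OF dense]]) auto
  ultimately have "(THE v. \<forall>x\<in>dom S. cinner (the (S x)) y = cinner x v) = w"
    by (intro the_equality)
  with * show ?thesis
    by (auto simp: adj_def)
qed

lemma adj_SomeD:
  assumes dense: "densely_defined S" and y: "adj S y = Some w" and x: "S x = Some u"
  shows "cinner u y = cinner x w"
proof -
  obtain v where "\<forall>x\<in>dom S. cinner (the (S x)) y = cinner x v"
    using y by (auto simp: adj_def split: if_splits)
  then have v: "\<And>x u. S x = Some u \<Longrightarrow> cinner u y = cinner x v"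
    by force
  have "adj S y = Some v"
    using dense v by (rule adj_SomeI)
  then show ?thesis
    using v[OF x] y by simp
qed

lemma op_linear_adj: "densely_defined S \<Longrightarrow> op_linear (adj S)"
  unfolding op_linear_def
  by (auto intro!: adj_SomeI simp: cinner_simps adj_SomeD)

lemma densely_defined_total: "densely_defined (\<lambda>x. Some (f x))"
  by (simp add: densely_defined_def dom_def)

lemma adj_total:
  assumes "\<And>x y. cinner (f x) y = cinner x (g y)"
  shows "adj (\<lambda>x. Some (f x)) = (\<lambda>y. Some (g y))"
  using assms by (auto intro!: adj_SomeI densely_defined_total)

lemma self_adjoint_symmetric:
  "self_adjoint S \<Longrightarrow> S x = Some u \<Longrightarrow> S y = Some v \<Longrightarrow> cinner u y = cinner x v"
  unfolding self_adjoint_def by (metis adj_SomeD)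

section \<open>Resolvents\<close>

lemma shift_Some_iff:
  "(z *\<^sub>o Some -\<^sub>o S) x = Some y \<longleftrightarrow> (\<exists>u. S x = Some u \<and> y = z *\<^sub>C x - u)"
  by (auto simp: op_diff_Some_iff op_scale_Some_iff)

lemma shift_eq: "S x = Some u \<Longrightarrow> (z *\<^sub>o Some -\<^sub>o S) x = Some (z *\<^sub>C x - u)"
  by (simp add: shift_Some_iff)

lemma dom_shift: "dom (z *\<^sub>o Some -\<^sub>o S) = dom S"
  by (auto simp: dom_def shift_Some_iff)

lemma op_inv_eqI:
  assumes "\<And>y. S (g y) = Some y" and "\<And>x y. S x = Some y \<Longrightarrow> g y = x"
  shows "op_inv S = (\<lambda>y. Some (g y))"
  using assms by (auto simp: op_inv_def ran_def fun_eq_iff intro!: the_equality)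

lemma resolvent_eqI:
  assumes "\<And>y. S (r y) = Some (z *\<^sub>C r y - y)"
    and "\<And>x u. S x = Some u \<Longrightarrow> r (z *\<^sub>C x - u) = x"
  shows "resolvent z S = (\<lambda>y. Some (r y))"
  unfolding resolvent_def
  using assms by (intro op_inv_eqI) (auto simp: shift_Some_iff)

lemma resolvent_setI:
  assumes "densely_defined S"
    and r: "\<And>y. S (r y) = Some (z *\<^sub>C r y - y)"
    and l: "\<And>x u. S x = Some u \<Longrightarrow> r (z *\<^sub>C x - u) = x"
    and "cbounded r"
  shows "z \<in> \<rho> S"
proof -
  have "bij_betw (\<lambda>x. the ((z *\<^sub>o Some -\<^sub>o S) x)) (dom (z *\<^sub>o Some -\<^sub>o S)) UNIV"
  proof (rule bij_betw_byWitness[where f' = r])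
    have "r y \<in> dom S \<and> the ((z *\<^sub>o Some -\<^sub>o S) (r y)) = y" for y
      using r[of y] shift_Some_iff[of z S "r y" y] by auto
    then show "\<forall>y\<in>UNIV. the ((z *\<^sub>o Some -\<^sub>o S) (r y)) = y"
      "r ` UNIV \<subseteq> dom (z *\<^sub>o Some -\<^sub>o S)"
      by (auto simp: dom_shift)
    show "\<forall>x\<in>dom (z *\<^sub>o Some -\<^sub>o S). r (the ((z *\<^sub>o Some -\<^sub>o S) x)) = x"
      by (auto simp: dom_shift shift_eq l)
  qed auto
  then show ?thesis
    using assms(1,4) by (auto simp: resolvent_set_def resolvent_eqI[OF r l] op_bounded_def cbounded_def)
qed

text \<open>Replaces the resolvent by a total function \<open>r\<close> with its two defining
  equations, so that later arguments avoid inverses of partial functions. Linearity of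
  \<open>r\<close> comes from applying the left inverse property to combinations of values of
  \<open>r\<close>.\<close>

lemma resolvent_setE:
  assumes z: "z \<in> \<rho> S" and lin: "op_linear S"
  obtains r where "resolvent z S = (\<lambda>y. Some (r y))" "\<And>y. S (r y) = Some (z *\<^sub>C r y - y)"
    "\<And>x u. S x = Some u \<Longrightarrow> r (z *\<^sub>C x - u) = x" "clinear r" "cbounded r"
proof -
  let ?Z = "z *\<^sub>o Some -\<^sub>o S"
  have bij: "bij_betw (\<lambda>x. the (?Z x)) (dom ?Z) UNIV" and bdd: "op_bounded (resolvent z S)"
    using z by (auto simp: resolvent_set_def)
  define r where "r = inv_into (dom ?Z) (\<lambda>x. the (?Z x))"
  have dom_r: "r y \<in> dom ?Z" and right: "the (?Z (r y)) = y" for y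
    using bij inv_into_into[of y "\<lambda>x. the (?Z x)" "dom ?Z"] f_inv_into_f[of y "\<lambda>x. the (?Z x)" "dom ?Z"]
    by (auto simp: r_def bij_betw_def)
  have Sr: "S (r y) = Some (z *\<^sub>C r y - y)" for y
  proof -
    obtain u where u: "S (r y) = Some u"
      using dom_r[of y] by (auto simp: dom_shift)
    then have "y = z *\<^sub>C r y - u"
      using right[of y] by (simp add: shift_eq)
    then have "u = z *\<^sub>C r y - y"
      by (metis diff_diff_eq2 add_diff_cancel_left')
    then show ?thesis using u by simp
  qed
  have rS: "r (z *\<^sub>C x - u) = x" if "S x = Some u" for x u
  proof -
    have "?Z x = Some (z *\<^sub>C x - u)"
      using that by (simp add: shift_Some_iff)
    then have "r (the (?Z x)) = x"
      using bij unfolding r_def bij_betw_def by (intro inv_into_f_f) auto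
    then show ?thesis
      using \<open>?Z x = _\<close> by simp
  qed
  have R: "resolvent z S = (\<lambda>y. Some (r y))"
    using Sr rS by (rule resolvent_eqI)
  moreover have "clinear r"
  proof -
    have "r (x + y) = r x + r y" for x y
      using rS[OF op_linear_add[OF lin Sr[of x] Sr[of y]]] by (simp add: scaleC_simps algebra_simps)
    moreover have "r (c *\<^sub>C x) = c *\<^sub>C r x" for c x
      using rS[OF op_linear_scaleC[OF lin Sr[of x], of c]]
      by (simp add: scaleC_simps mult.commute[of c])
    ultimately show ?thesis by (simp add: clinear_def)
  qed
  moreover have "cbounded r"
    using bdd by (auto simp: R op_bounded_def intro: cboundedI)
  ultimately show ?thesis
    using Sr rS that by blast
qed

text \<open>The adjoint \<open>q\<close> of the resolvent at \<open>z\<close> is the resolvent at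
  \<open>cnj z\<close>: its values lie in the domain of \<open>adj S\<close>, which is
  \<open>S\<close> itself, and symmetry gives the left inverse.\<close>

lemma self_adjoint_resolvent:
  assumes S: "self_adjoint S" and z: "z \<in> \<rho> S"
  shows "cnj z \<in> \<rho> S"
proof -
  have lin: "op_linear S" and dense: "densely_defined S" and adj: "adj S = S"
    using S by (auto simp: self_adjoint_def)
  obtain r where r: "\<And>y. S (r y) = Some (z *\<^sub>C r y - y)"
    "\<And>x u. S x = Some u \<Longrightarrow> r (z *\<^sub>C x - u) = x" "clinear r" "cbounded r"
    using resolvent_setE[OF z lin] by metis
  obtain q where q: "clinear q" "cbounded q" "\<And>x y. cinner (r x) y = cinner x (q y)"
    using bounded_adjoint[OF r(3,4)] by metis
  show ?thesis
  proof (rule resolvent_setI[OF dense _ _ q(2)])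
    fix y
    have "adj S (q y) = Some (cnj z *\<^sub>C q y - y)"
    proof (rule adj_SomeI[OF dense])
      fix x u assume "S x = Some u"
      then have "cinner x y = cinner (z *\<^sub>C x - u) (q y)"
        using r(2) q(3) by metis
      then show "cinner u (q y) = cinner x (cnj z *\<^sub>C q y - y)"
        by (simp add: cinner_simps)
    qed
    then show "S (q y) = Some (cnj z *\<^sub>C q y - y)"
      by (simp add: adj)
  next
    fix x u assume x: "S x = Some u"
    show "q (cnj z *\<^sub>C x - u) = x"
    proof (rule cinner_eqI)
      fix y
      have "cinner y (q (cnj z *\<^sub>C x - u)) = cinner (z *\<^sub>C r y - (z *\<^sub>C r y - y)) x"
        using self_adjoint_symmetric[OF S r(1)[of y] x]
        by (simp add: q(3)[symmetric] cinner_simps algebra_simps)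
      then show "cinner y (q (cnj z *\<^sub>C x - u)) = cinner y x" by simp
    qed
  qed
qed

lemma self_adjoint_resolvents:
  assumes S: "self_adjoint S"
    and r: "\<And>y. S (r y) = Some (z *\<^sub>C r y - y)" and q: "\<And>y. S (q y) = Some (cnj z *\<^sub>C q y - y)"
  shows "cinner (r x) y = cinner x (q y)"
  using self_adjoint_symmetric[OF S r[of x] q[of y]] by (simp add: cinner_simps)

text \<open>For a densely defined \<open>X\<close> with bounded inverse \<open>g\<close>, an everywhere defined adjoint
  is automatically a bounded operator, with inverse \<open>g\<^sup>*\<close>.\<close>

lemma adjoint_of_inverse:
  assumes dense: "densely_defined X"
    and X: "\<And>y. X (g y) = Some y" "\<And>x y. X x = Some y \<Longrightarrow> g y = x"
    and g: "\<And>x y. cinner (g x) y = cinner x (g' y)"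
    and adj: "adj X = (\<lambda>y. Some (x' y))"
  shows "g' (x' y) = y" "x' (g' y) = y" "cbounded x'" "clinear x'"
proof -
  have x': "cinner u y = cinner x (x' y)" if "X x = Some u" for x u y
    using adj_SomeD[OF dense, of y "x' y"] that adj by simp
  show "g' (x' y) = y"
    by (rule cinner_eqI) (metis g x' X(1))
  have "adj X (g' y) = Some y"
    using g X(2) by (intro adj_SomeI[OF dense]) metis
  then show "x' (g' y) = y"
    by (simp add: adj)
  show "cbounded x'"
    using x' by (intro Hellinger_Toeplitz_dense[OF densely_definedD[OF dense], of "\<lambda>u. the (X u)"]) auto
  show "clinear x'"
    using op_linear_adj[OF dense] by (simp add: adj op_linear_total)
qed

section \<open>Self-adjointness under relatively bounded perturbations\<close>

text \<open>The product norm is the Euclidean one, so the block operator argument can be carried out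
  in components.\<close>

lemma norm_Pair_square: "(norm (x, y))\<^sup>2 = (norm x)\<^sup>2 + (norm y)\<^sup>2"
  by (simp add: norm_Pair)

lemma norm_Pair_mono: "norm x \<le> norm x' \<Longrightarrow> norm y \<le> norm y' \<Longrightarrow> norm (x, y) \<le> norm (x', y')"
  by (auto simp: norm_Pair intro!: add_mono power_mono)

text \<open>Here \<open>W\<close> is the inverse of an operator \<open>S\<close> and \<open>N = V W\<close>, where \<open>H - \<mu> = S + V\<close>; accordingly
  \<open>W' = (S\<^sup>*)\<^sup>-\<^sup>1\<close> and \<open>H - cnj \<mu> = S\<^sup>* + V'\<close>. As in the Kato--Rellich theorem for the self-adjoint
  block operator with entries \<open>S\<close> and \<open>S\<^sup>*\<close>, one solves \<open>(H - \<mu>) u + i c v = p\<close>,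
  \<open>(H - cnj \<mu>) v + i c u = q\<close> for large \<open>c\<close>.\<close>

theorem self_adjoint_perturbation:
  fixes H :: "'a::chilbert_space \<rightharpoonup> 'a"
  assumes lin: "op_linear H" and dense: "densely_defined H"
    and sym: "\<And>f g u v. H f = Some u \<Longrightarrow> H g = Some v \<Longrightarrow> cinner u g = cinner f v"
    and W: "clinear W" "cbounded W" and W': "clinear W'" "cbounded W'"
    and adjoint: "\<And>x y. cinner (W x) y = cinner x (W' y)"
    and HW: "\<And>x. H (W x) = Some (\<mu> *\<^sub>C W x + x + N x)"
    and HW': "\<And>x. H (W' x) = Some (cnj \<mu> *\<^sub>C W' x + x + N' x)"
    and N: "a < 1" "\<And>x. norm (N x) \<le> a * norm x + b * norm (W x)"
    and N': "a' < 1" "\<And>x. norm (N' x) \<le> a' * norm x + b' * norm (W' x)"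
  shows "self_adjoint H"
proof -
  define A where "A = max 0 (max a a')"
  define B where "B = max 0 (max b b')"
  have A: "0 \<le> A" "A < 1" "a \<le> A" "a' \<le> A" and B: "0 \<le> B" "b \<le> B" "b' \<le> B"
    using N N' by (auto simp: A_def B_def)
  \<comment> \<open>Since \<open>W'\<close> is the adjoint of \<open>W\<close>, \<open>J\<close> is
    \<open>\<i>\<close> times a symmetric block operator. The cross terms in the norm of
    \<open>w + c *\<^sub>R J w\<close> therefore have real part 0, which gives
    \<open>norm_sq\<close> and both lower bounds needed for the continuation in
    \<open>c\<close>.\<close>
  define J where "J w = (\<i> *\<^sub>C W' (snd w), \<i> *\<^sub>C W (fst w))" for w
  define P where "P w = (N (fst w), N' (snd w))" for w
  \<comment> \<open>\<open>N\<close> is determined by \<open>H\<close> and \<open>W\<close> through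
    \<open>HW\<close> and inherits linearity from them.\<close>
  have linear_N: "clinear N"
  proof -
    have N_eq: "N x = the (H (W x)) - \<mu> *\<^sub>C W x - x" for x
      by (simp add: HW)
    show ?thesis
      unfolding clinear_def N_eq
      by (auto simp: clinear_add[OF W(1)] clinear_scaleC[OF W(1)] op_linear_add[OF lin HW HW]
          op_linear_scaleC[OF lin HW] HW scaleC_simps algebra_simps mult.commute[of \<mu>])
  qed
  have linear_N': "clinear N'"
  proof -
    have N_eq: "N' x = the (H (W' x)) - cnj \<mu> *\<^sub>C W' x - x" for x
      by (simp add: HW')
    show ?thesis
      unfolding clinear_def N_eq
      by (auto simp: clinear_add[OF W'(1)] clinear_scaleC[OF W'(1)] op_linear_add[OF lin HW' HW']
          op_linear_scaleC[OF lin HW'] HW' scaleC_simps algebra_simps mult.commute[of "cnj \<mu>"])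
  qed
  have "linear P"
    using clinear_imp_linear[OF linear_N] clinear_imp_linear[OF linear_N']
    by (auto intro!: linearI simp: P_def linear_add linear_scale)
  have "bounded_linear J"
  proof -
    have bl: "bounded_linear (\<lambda>x. \<i> *\<^sub>C V x)" if V: "clinear V" "cbounded V" for V :: "'a \<Rightarrow> 'a"
    proof -
      obtain K where "\<And>x. norm (V x) \<le> K * norm x"
        using cboundedE[OF V(2)] by metis
      then show ?thesis
        using clinear_imp_linear[OF V(1)]
        by (intro bounded_linear_intro[where K=K])
          (auto simp: clinear_add[OF V(1)] clinear_scaleC[OF V(1)] scaleR_scaleC scaleC_simps mult.commute)
    qed
    show ?thesis
      unfolding J_def
      by (intro bounded_linear_Pair bounded_linear_compose[OF bl[OF W']]
          bounded_linear_compose[OF bl[OF W]] bounded_linear_fst bounded_linear_snd)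
  qed
  have norm_sq: "(norm (w + c *\<^sub>R J w))\<^sup>2 = (norm w)\<^sup>2 + (c * norm (J w))\<^sup>2" for c w
  proof -
    obtain x y where w: "w = (x, y)" by (cases w)
    have "cinner y (W x) = cnj (cinner x (W' y))"
      using adjoint[of x y] by (metis cinner_commute)
    then have "Re (cinner x (c *\<^sub>R \<i> *\<^sub>C W' y)) + Re (cinner y (c *\<^sub>R \<i> *\<^sub>C W x)) = 0"
      by (simp add: scaleR_scaleC cinner_simps)
    then show ?thesis
      by (simp add: w J_def norm_Pair_square norm_square_add power_mult_distrib algebra_simps)
  qed
  have bound: "norm w \<le> norm (w + c *\<^sub>R J w)" "c * norm (J w) \<le> norm (w + c *\<^sub>R J w)" for c w
    using norm_sq[of w c] by (auto intro!: power2_le_imp_le[OF _ norm_ge_zero])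
  \<comment> \<open>The threshold is chosen to give \<open>A + B / c < 1\<close>; the 1 in the
    numerator makes it positive even for \<open>B = 0\<close>.\<close>
  obtain c where c: "(B + 1) / (1 - A) < c" and surj: "surj (\<lambda>w. w + c *\<^sub>R J w)"
    using surj_continuation[OF \<open>bounded_linear J\<close>] bound by metis
  have "0 < (B + 1) / (1 - A)"
    using A B by (intro divide_pos_pos) auto
  then have "0 < c" using c by simp
  have "B < (1 - A) * c"
    using c A(2) by (simp add: field_simps)
  then have k: "A + B / c < 1"
    using \<open>0 < c\<close> by (simp add: field_simps)
  have "surj (\<lambda>w. (w + c *\<^sub>R J w) + P w)"
  proof (rule surj_perturbation[OF _ \<open>linear P\<close> surj k])
    show "linear (\<lambda>w. w + c *\<^sub>R J w)"
      by (intro bounded_linear.linear bounded_linear_add bounded_linear_ident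
          bounded_linear_compose[OF bounded_linear_scaleR_right \<open>bounded_linear J\<close>])
    fix w :: "'a \<times> 'a"
    obtain x y where w: "w = (x, y)" by (cases w)
    have "norm (N x) \<le> norm (A * norm x + B * norm (W x))"
      using N(2)[of x] mult_right_mono[OF A(3), of "norm x"] mult_right_mono[OF B(2), of "norm (W x)"]
      by simp
    moreover have "norm (N' y) \<le> norm (A * norm y + B * norm (W' y))"
      using N'(2)[of y] mult_right_mono[OF A(4), of "norm y"] mult_right_mono[OF B(3), of "norm (W' y)"]
      by simp
    \<comment> \<open>The triangle inequality in the plane separates the \<open>A\<close> part from
      the \<open>B\<close> part and keeps the coefficient of \<open>norm w\<close> equal to
      \<open>A\<close>, hence below 1.\<close>
    ultimately have "norm (P w) \<le> norm (A *\<^sub>R (norm x, norm y) + B *\<^sub>R (norm (W x), norm (W' y)))"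
      by (auto simp: P_def w intro!: norm_Pair_mono)
    also have "\<dots> \<le> A * norm (norm x, norm y) + B * norm (norm (W x), norm (W' y))"
      using A(1) B(1)
      by (intro order_trans[OF norm_triangle_ineq]) (simp only: norm_scaleR abs_of_nonneg order_refl)
    also have "\<dots> = A * norm w + B * norm (J w)"
      by (simp add: w J_def norm_Pair add.commute)
    also have "\<dots> \<le> A * norm (w + c *\<^sub>R J w) + B * (norm (w + c *\<^sub>R J w) / c)"
      using bound[where c = c and w = w] A(1) B(1) \<open>0 < c\<close>
      by (intro add_mono mult_left_mono) (auto simp: field_simps)
    finally show "norm (P w) \<le> (A + B / c) * norm (w + c *\<^sub>R J w)"
      by (simp add: algebra_simps)
  qed
  note surj_P = this
  have solve: "\<exists>x y. x + (c * \<i>) *\<^sub>C W' y + N x = p \<and> y + (c * \<i>) *\<^sub>C W x + N' y = q" for p q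
  proof -
    obtain w where "(p, q) = (w + c *\<^sub>R J w) + P w"
      using surjD[OF surj_P] by blast
    then show ?thesis
      by (cases w) (auto simp: J_def P_def scaleR_scaleC scaleC_scaleC)
  qed
  have "H g = Some h" if g: "adj H g = Some h" for g h
  proof -
    \<comment> \<open>With \<open>u = W x\<close> and \<open>v = W' y\<close>, these right-hand
      sides are the ones that \<open>u = 0\<close>, \<open>v = g\<close> would produce if
      \<open>H g\<close> were equal to \<open>h\<close>. The rest shows that this is indeed the
      solution.\<close>
    obtain x y where x: "x + (c * \<i>) *\<^sub>C W' y + N x = (c * \<i>) *\<^sub>C g"
      and y: "y + (c * \<i>) *\<^sub>C W x + N' y = h - cnj \<mu> *\<^sub>C g"
      using solve by blast
    define e where "e = g - W' y"
    have Hu: "H (W x) = Some (\<mu> *\<^sub>C W x + (c * \<i>) *\<^sub>C e)"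
      using HW[of x] x by (simp add: e_def scaleC_diff_right algebra_simps)
    have Hv: "H (W' y) = Some (h - cnj \<mu> *\<^sub>C e - (c * \<i>) *\<^sub>C W x)"
      using HW'[of y] y by (simp add: e_def scaleC_diff_right algebra_simps)
    \<comment> \<open>\<open>H u\<close> is paired with \<open>e = g - v\<close>, using the adjoint
      relation for \<open>g\<close> and symmetry for \<open>v\<close>. The \<open>\<mu>\<close>
      terms cancel, leaving that the sum of the squared norms of \<open>e\<close> and
      \<open>u\<close> is 0.\<close>
    have "cinner (\<mu> *\<^sub>C W x + (c * \<i>) *\<^sub>C e) e = cinner (W x) (cnj \<mu> *\<^sub>C e + (c * \<i>) *\<^sub>C W x)"
      using adj_SomeD[OF dense g Hu] sym[OF Hu Hv]
      by (simp add: e_def cinner_diff_right cinner_add_right)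
    then have "(c * \<i>) * (cinner e e + cinner (W x) (W x)) = 0"
      by (simp add: cinner_simps algebra_simps)
    then have "complex_of_real ((norm e)\<^sup>2 + (norm (W x))\<^sup>2) = 0"
      using \<open>0 < c\<close> by (simp add: cinner_self)
    then have "(norm e)\<^sup>2 + (norm (W x))\<^sup>2 = 0"
      unfolding of_real_eq_0_iff .
    then have "e = 0" "W x = 0"
      by (auto simp: sum_power2_eq_zero_iff)
    then show ?thesis
      using Hv by (simp add: e_def)
  qed
  moreover have "adj H g = Some h" if "H g = Some h" for g h
    using that sym by (intro adj_SomeI[OF dense]) blast
  ultimately have "adj H = H"
    by (intro ext) (metis option.exhaust)
  then show ?thesis
    using lin dense by (simp add: self_adjoint_def)
qed

section \<open>The boundary setting\<close>

context ibc_setting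
begin

lemma L_op_Some_iff: "L_op Lm B f = Some l \<longleftrightarrow> Lm f = Some l \<and> B f = Some 0"
  by (auto simp: L_op_def op_ker_def restrict_map_def)

lemma A_op_Some_iff: "A_op Am B f = Some a \<longleftrightarrow> Am f = Some a \<and> B f = Some 0"
  by (auto simp: A_op_def op_ker_def restrict_map_def)

lemma L_op_linear: "op_linear (L_op Lm B)"
  using L_self_adjoint by (simp add: self_adjoint_def)

lemma L_op_dom_Am:
  assumes "L_op Lm B f = Some l" obtains a where "Am f = Some a"
proof -
  have "f \<in> dom (A_op Am B)"
    using A_rel_bounded assms by (auto simp: rel_bounded_def)
  then show ?thesis
    using that by (auto simp: A_op_Some_iff)
qed

definition I_fun :: "'b \<Rightarrow> 'h" where "I_fun \<phi> = the (I \<phi>)"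

definition I_adj :: "'h \<Rightarrow> 'b" where "I_adj f = the (adj I f)"

lemma I_total:
  shows I_eq: "I \<phi> = Some (I_fun \<phi>)" and adj_I_eq: "adj I f = Some (I_adj f)"
    and I_fun_clinear: "clinear I_fun" and I_adj_clinear: "clinear I_adj"
    and I_fun_adjoint: "cinner (I_fun \<phi>) f = cinner \<phi> (I_adj f)"
proof -
  obtain i where i: "I = (\<lambda>x. Some (i x))" "clinear i" "cbounded i"
    using total_op[OF I_linear I_dom I_bounded] by metis
  obtain j where j: "clinear j" "\<And>x y. cinner (i x) y = cinner x (j y)"
    using bounded_adjoint[OF i(2,3)] by metis
  have adj: "adj I = (\<lambda>y. Some (j y))"
    using adj_total[of i j] j(2) i(1) by simp
  have I_fun: "I_fun = i" "I_adj = j"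
    using i(1) adj by (auto simp: fun_eq_iff I_fun_def I_adj_def)
  show "I \<phi> = Some (I_fun \<phi>)" "adj I f = Some (I_adj f)"
    unfolding I_fun by (rule fun_cong[OF i(1)], rule fun_cong[OF adj])
  show "clinear I_fun" "clinear I_adj" "cinner (I_fun \<phi>) f = cinner \<phi> (I_adj f)"
    unfolding I_fun by (fact i j)+
qed

section \<open>The operators G and T of the abstract setting\<close>

definition G\<^sub>0 :: "complex \<Rightarrow> 'b \<Rightarrow> 'h" where "G\<^sub>0 \<mu> \<phi> = the (G_op Lm Am B \<mu> \<phi>)"

context
  fixes \<mu> assumes \<mu>: "\<mu> \<in> \<rho> (L_op Lm B)"
begin

lemma cnj_\<mu>: "cnj \<mu> \<in> \<rho> (L_op Lm B)"
  by (rule self_adjoint_resolvent[OF L_self_adjoint \<mu>])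

text \<open>That \<open>B\<close> composed with the adjoint is the identity forces the adjoint to be
  defined everywhere, so \<open>G\<^sub>0\<close> is a genuine function. The assumptions are applied
  at \<open>cnj \<mu>\<close>, because \<open>G_op\<close> at \<open>\<mu>\<close> is built from the
  resolvent at \<open>cnj \<mu>\<close>.\<close>

lemma G\<^sub>0:
  shows G_op_eq: "G_op Lm Am B \<mu> \<phi> = Some (G\<^sub>0 \<mu> \<phi>)"
    and Lm_G\<^sub>0: "Lm (G\<^sub>0 \<mu> \<phi>) = Some (\<mu> *\<^sub>C G\<^sub>0 \<mu> \<phi>)"
    and B_G\<^sub>0: "B (G\<^sub>0 \<mu> \<phi>) = Some \<phi>"
proof -
  let ?S = "A_op Am B \<circ>\<^sub>m resolvent (cnj \<mu>) (L_op Lm B)"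
  have "(B \<circ>\<^sub>m adj ?S) \<phi> = Some \<phi>"
    by (simp add: B_adj_AR[OF cnj_\<mu>])
  then obtain w where w: "adj ?S \<phi> = Some w" "B w = Some \<phi>"
    by (auto simp: map_comp_Some_iff)
  then have "w \<in> op_ker (\<mu> *\<^sub>o Some -\<^sub>o Lm)"
    using ran_adj_AR[OF cnj_\<mu>] by (auto intro: ranI)
  then have "Lm w = Some (\<mu> *\<^sub>C w)"
    by (auto simp: op_ker_def shift_Some_iff)
  moreover have "G\<^sub>0 \<mu> \<phi> = w"
    by (simp add: G\<^sub>0_def G_op_def w)
  ultimately show "G_op Lm Am B \<mu> \<phi> = Some (G\<^sub>0 \<mu> \<phi>)" "Lm (G\<^sub>0 \<mu> \<phi>) = Some (\<mu> *\<^sub>C G\<^sub>0 \<mu> \<phi>)"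
    "B (G\<^sub>0 \<mu> \<phi>) = Some \<phi>"
    using w by (auto simp: G_op_def)
qed

lemma T_op_Some_iff: "T_op Lm Am B \<mu> \<phi> = Some t \<longleftrightarrow> Am (G\<^sub>0 \<mu> \<phi>) = Some t"
  by (simp add: T_op_def map_comp_Some_iff G_op_eq)

text \<open>The definition of G as an adjoint, freed of the resolvent: \<open>g\<close> is the
  resolvent at \<open>cnj \<mu>\<close> applied to \<open>cnj \<mu> *\<^sub>C g - l\<close>.\<close>

lemma G\<^sub>0_adjoint:
  assumes g: "L_op Lm B g = Some l" "Am g = Some a"
  shows "cinner \<phi> a = cinner (G\<^sub>0 \<mu> \<phi>) (cnj \<mu> *\<^sub>C g - l)"
proof -
  let ?S = "A_op Am B \<circ>\<^sub>m resolvent (cnj \<mu>) (L_op Lm B)"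
  obtain r where r: "resolvent (cnj \<mu>) (L_op Lm B) = (\<lambda>y. Some (r y))"
    "\<And>y. L_op Lm B (r y) = Some (cnj \<mu> *\<^sub>C r y - y)"
    "\<And>x u. L_op Lm B x = Some u \<Longrightarrow> r (cnj \<mu> *\<^sub>C x - u) = x"
    using resolvent_setE[OF cnj_\<mu> L_op_linear] by metis
  have "\<exists>u. ?S y = Some u" for y
  proof -
    obtain u where "Am (r y) = Some u"
      using L_op_dom_Am[OF r(2)] by metis
    then have "?S y = Some u"
      using r(2)[of y] by (simp add: r(1) map_comp_Some_iff A_op_Some_iff L_op_Some_iff)
    then show ?thesis by blast
  qed
  then have "dom ?S = UNIV"
    by blast
  then have "densely_defined ?S"
    by (simp add: densely_defined_def)
  moreover have "adj ?S \<phi> = Some (G\<^sub>0 \<mu> \<phi>)"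
    using G_op_eq by (simp add: G_op_def)
  moreover have "?S (cnj \<mu> *\<^sub>C g - l) = Some a"
    using g by (simp add: r(1) r(3)[OF g(1)] map_comp_Some_iff A_op_Some_iff L_op_Some_iff)
  ultimately have "cinner a \<phi> = cinner (cnj \<mu> *\<^sub>C g - l) (G\<^sub>0 \<mu> \<phi>)"
    by (rule adj_SomeD)
  then show ?thesis
    by (metis cinner_commute)
qed

text \<open>The difference of two solutions with equal \<open>B\<close> value lies in the kernel of
  \<open>L - \<mu>\<close>, which is trivial because \<open>\<mu>\<close> is in the resolvent
  set.\<close>

lemma G\<^sub>0_unique:
  assumes f: "Lm f = Some (\<mu> *\<^sub>C f)" "B f = Some b"
  shows "f = G\<^sub>0 \<mu> b"
proof -
  obtain r where r: "\<And>x u. L_op Lm B x = Some u \<Longrightarrow> r (\<mu> *\<^sub>C x - u) = x"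
    using resolvent_setE[OF \<mu> L_op_linear] by metis
  have "L_op Lm B (f - G\<^sub>0 \<mu> b) = Some (\<mu> *\<^sub>C (f - G\<^sub>0 \<mu> b))"
    using op_linear_diff[OF Lm_linear f(1) Lm_G\<^sub>0[of b]] op_linear_diff[OF B_linear f(2) B_G\<^sub>0[of b]]
    by (simp add: L_op_Some_iff scaleC_diff_right)
  then have "r 0 = f - G\<^sub>0 \<mu> b"
    using r by fastforce
  moreover have "r 0 = 0"
    using r[OF op_linear_0[OF L_op_linear]] by simp
  ultimately show ?thesis by simp
qed

text \<open>Subtracting \<open>G\<^sub>0 \<mu> b\<close> removes the \<open>B\<close> value, so the
  remainder lies in the domain of \<open>L\<close> and hence of \<open>Am\<close>. It follows that
  \<open>G\<^sub>0 \<mu> b\<close> lies in the domain of \<open>Am\<close>, that is,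
  \<open>b\<close> lies in the domain of T.\<close>

lemma L_op_decomposition:
  assumes f: "Lm f = Some l" "Am f = Some a" "B f = Some b"
  obtains a\<^sub>0 where "L_op Lm B (f - G\<^sub>0 \<mu> b) = Some (l - \<mu> *\<^sub>C G\<^sub>0 \<mu> b)"
    "Am (f - G\<^sub>0 \<mu> b) = Some a\<^sub>0" "T_op Lm Am B \<mu> b = Some (a - a\<^sub>0)"
proof -
  have L: "L_op Lm B (f - G\<^sub>0 \<mu> b) = Some (l - \<mu> *\<^sub>C G\<^sub>0 \<mu> b)"
    using op_linear_diff[OF Lm_linear f(1) Lm_G\<^sub>0[of b]] op_linear_diff[OF B_linear f(3) B_G\<^sub>0[of b]]
    by (simp add: L_op_Some_iff)
  then obtain a\<^sub>0 where a\<^sub>0: "Am (f - G\<^sub>0 \<mu> b) = Some a\<^sub>0"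
    using L_op_dom_Am by metis
  have "T_op Lm Am B \<mu> b = Some (a - a\<^sub>0)"
    using op_linear_diff[OF Am_linear f(2) a\<^sub>0] by (simp add: T_op_Some_iff)
  then show ?thesis
    using L a\<^sub>0 that by blast
qed

end

text \<open>Splitting \<open>f = f\<^sub>0 + G\<^sub>\<mu> B f\<close> and \<open>g = g\<^sub>0 + G\<^sub>\<mu>\<^sub>' B g\<close>, where \<open>\<mu>'\<close> is conjugate to \<open>\<mu>\<close>,
  reduces the identity to the symmetry of \<open>L\<close> and \<open>T\<close>.\<close>

lemma Green_identity:
  assumes \<mu>: "\<mu> \<in> \<rho> (L_op Lm B)"
    and f: "Lm f = Some l" "Am f = Some a" "B f = Some b"
    and g: "Lm g = Some l'" "Am g = Some a'" "B g = Some b'"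
  shows "cinner l g - cinner f l' = cinner b a' - cinner a b'"
proof -
  define F where "F = G\<^sub>0 \<mu> b"
  define F' where "F' = G\<^sub>0 (cnj \<mu>) b'"
  note \<mu>' = cnj_\<mu>[OF \<mu>]
  obtain a\<^sub>0 where f\<^sub>0: "L_op Lm B (f - F) = Some (l - \<mu> *\<^sub>C F)" "Am (f - F) = Some a\<^sub>0"
    "T_op Lm Am B \<mu> b = Some (a - a\<^sub>0)"
    using L_op_decomposition[OF \<mu> f] unfolding F_def by metis
  obtain a\<^sub>0' where g\<^sub>0: "L_op Lm B (g - F') = Some (l' - cnj \<mu> *\<^sub>C F')" "Am (g - F') = Some a\<^sub>0'"
    "T_op Lm Am B (cnj \<mu>) b' = Some (a' - a\<^sub>0')"
    using L_op_decomposition[OF \<mu>' g] unfolding F'_def by metis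
  have sym: "cinner (l - \<mu> *\<^sub>C F) (g - F') = cinner (f - F) (l' - cnj \<mu> *\<^sub>C F')"
    by (rule self_adjoint_symmetric[OF L_self_adjoint f\<^sub>0(1) g\<^sub>0(1)])
  have 1: "cinner b a\<^sub>0' = cinner F (cnj \<mu> *\<^sub>C (g - F') - (l' - cnj \<mu> *\<^sub>C F'))"
    unfolding F_def by (rule G\<^sub>0_adjoint[OF \<mu> g\<^sub>0(1,2)])
  have "cinner b' a\<^sub>0 = cinner F' (\<mu> *\<^sub>C (f - F) - (l - \<mu> *\<^sub>C F))"
    using G\<^sub>0_adjoint[OF \<mu>' f\<^sub>0(1,2), of b'] by (simp add: F'_def)
  then have 2: "cinner a\<^sub>0 b' = cinner (\<mu> *\<^sub>C (f - F) - (l - \<mu> *\<^sub>C F)) F'"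
    by (metis cinner_commute)
  \<comment> \<open>The symmetry of T enters here: T at \<open>cnj \<mu>\<close> is contained in the
    adjoint of T at \<open>\<mu>\<close>.\<close>
  have "adj (T_op Lm Am B \<mu>) b' = Some (a' - a\<^sub>0')"
    using T_adj[OF \<mu>] g\<^sub>0(3) by (auto simp: map_le_def dest: bspec)
  then have 3: "cinner (a - a\<^sub>0) b' = cinner b (a' - a\<^sub>0')"
    by (rule adj_SomeD[OF T_dense[OF \<mu>] _ f\<^sub>0(3)])
  show ?thesis
    using sym 1 2 3 unfolding cinner_simps complex_cnj_cnj by algebra
qed

end

section \<open>Robin type boundary conditions\<close>

locale ibc_robin = ibc_setting Lm Am B I
  for Lm :: "'h::chilbert_space \<rightharpoonup> 'h" and Am :: "'h \<rightharpoonup> 'b::chilbert_space"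
    and B :: "'h \<rightharpoonup> 'b" and I :: "'b \<rightharpoonup> 'h" +
  fixes \<alpha> \<beta> \<gamma> \<delta> :: complex
  assumes real_\<alpha>\<gamma>: "cnj \<alpha> * \<gamma> \<in> \<real>" and real_\<beta>\<delta>: "cnj \<beta> * \<delta> \<in> \<real>"
    and det: "\<beta> * cnj \<gamma> - cnj \<alpha> * \<delta> = 1"
    and Lab_self_adjoint: "self_adjoint (L_ab Lm Am B \<alpha> \<beta>)"
begin

abbreviation "Lab \<equiv> L_ab Lm Am B \<alpha> \<beta>"
abbreviation "Gab \<equiv> G_ab Lm Am B \<alpha> \<beta> \<gamma> \<delta>"
abbreviation "Tab \<equiv> T_ab Lm Am B \<alpha> \<beta> \<gamma> \<delta>"
abbreviation "H \<equiv> H_IBC Lm Am B I \<alpha> \<beta> \<gamma> \<delta>"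

definition Q :: "'h \<Rightarrow> 'b" where "Q f = \<gamma> *\<^sub>C the (Am f) + \<delta> *\<^sub>C the (B f)"

lemma Q_eq: "Am f = Some a \<Longrightarrow> B f = Some b \<Longrightarrow> Q f = \<gamma> *\<^sub>C a + \<delta> *\<^sub>C b"
  by (simp add: Q_def)

text \<open>The reality conditions cancel the terms pairing \<open>a\<close> with \<open>a'\<close>
  and \<open>b\<close> with \<open>b'\<close>. The determinant condition and its conjugate give the
  coefficients of the mixed terms.\<close>

lemma boundary_form:
  "cinner (\<alpha> *\<^sub>C a + \<beta> *\<^sub>C b) (\<gamma> *\<^sub>C a' + \<delta> *\<^sub>C b') - cinner (\<gamma> *\<^sub>C a + \<delta> *\<^sub>C b) (\<alpha> *\<^sub>C a' + \<beta> *\<^sub>C b')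
    = cinner b a' - cinner a (b'::'b)"
proof -
  have "cnj \<gamma> * \<alpha> = cnj \<alpha> * \<gamma>" "cnj \<delta> * \<beta> = cnj \<beta> * \<delta>"
    using real_\<alpha>\<gamma> real_\<beta>\<delta> unfolding Reals_cnj_iff by (auto simp: mult.commute)
  moreover have "cnj \<beta> * \<gamma> - \<alpha> * cnj \<delta> = 1"
    using arg_cong[OF det, of cnj] by simp
  ultimately show ?thesis
    using det unfolding cinner_simps by algebra
qed

lemma Lab_Some_iff:
  "Lab f = Some l \<longleftrightarrow> Lm f = Some l \<and> (\<exists>a b. Am f = Some a \<and> B f = Some b \<and> \<alpha> *\<^sub>C a + \<beta> *\<^sub>C b = 0)"
proof -
  have "Lm f = Some l \<Longrightarrow> \<exists>b. B f = Some b"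
    using B_dom by blast
  then show ?thesis
    by (auto simp: L_ab_def restrict_map_def)
qed

lemma H_Some_iff:
  "H f = Some k \<longleftrightarrow> (\<exists>l a b. Lm f = Some l \<and> Am f = Some a \<and> B f = Some b \<and>
     \<alpha> *\<^sub>C a + \<beta> *\<^sub>C b = I_adj f \<and> k = l + I_fun (\<gamma> *\<^sub>C a + \<delta> *\<^sub>C b))"
proof -
  have "f \<in> dom Lm \<Longrightarrow> \<exists>b. B f = Some b"
    using B_dom by blast
  then show ?thesis
    by (auto simp: H_IBC_def restrict_map_def op_add_Some_iff op_scale_Some_iff map_comp_Some_iff
        I_eq adj_I_eq clinear_add[OF I_fun_clinear] clinear_scaleC[OF I_fun_clinear] add.assoc)
qed

lemma H_linear: "op_linear H"
  unfolding op_linear_def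
proof (intro conjI allI impI)
  show "H 0 = Some 0"
    using op_linear_0[OF Lm_linear] op_linear_0[OF Am_linear] op_linear_0[OF B_linear]
      clinear_diff[OF I_adj_clinear, of 0 0] clinear_diff[OF I_fun_clinear, of 0 0]
    by (auto simp: H_Some_iff)
next
  fix x y u v assume "H x = Some u" "H y = Some v"
  then obtain l a b l' a' b' where x: "Lm x = Some l" "Am x = Some a" "B x = Some b"
    "\<alpha> *\<^sub>C a + \<beta> *\<^sub>C b = I_adj x" "u = l + I_fun (\<gamma> *\<^sub>C a + \<delta> *\<^sub>C b)"
    and y: "Lm y = Some l'" "Am y = Some a'" "B y = Some b'"
    "\<alpha> *\<^sub>C a' + \<beta> *\<^sub>C b' = I_adj y" "v = l' + I_fun (\<gamma> *\<^sub>C a' + \<delta> *\<^sub>C b')"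
    unfolding H_Some_iff by metis
  have "\<alpha> *\<^sub>C (a + a') + \<beta> *\<^sub>C (b + b') = I_adj (x + y)"
    by (simp add: clinear_add[OF I_adj_clinear] x(4)[symmetric] y(4)[symmetric] scaleC_simps)
  moreover have "u + v = (l + l') + I_fun (\<gamma> *\<^sub>C (a + a') + \<delta> *\<^sub>C (b + b'))"
    by (simp add: x(5) y(5) clinear_add[OF I_fun_clinear] scaleC_simps)
  ultimately show "H (x + y) = Some (u + v)"
    using op_linear_add[OF Lm_linear x(1) y(1)] op_linear_add[OF Am_linear x(2) y(2)]
      op_linear_add[OF B_linear x(3) y(3)]
    unfolding H_Some_iff by blast
next
  fix c x u assume "H x = Some u"
  then obtain l a b where x: "Lm x = Some l" "Am x = Some a" "B x = Some b"
    "\<alpha> *\<^sub>C a + \<beta> *\<^sub>C b = I_adj x" "u = l + I_fun (\<gamma> *\<^sub>C a + \<delta> *\<^sub>C b)"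
    unfolding H_Some_iff by metis
  have "\<alpha> *\<^sub>C c *\<^sub>C a + \<beta> *\<^sub>C c *\<^sub>C b = I_adj (c *\<^sub>C x)"
    by (simp add: clinear_scaleC[OF I_adj_clinear] x(4)[symmetric] scaleC_simps mult.commute)
  moreover have "c *\<^sub>C u = c *\<^sub>C l + I_fun (\<gamma> *\<^sub>C c *\<^sub>C a + \<delta> *\<^sub>C c *\<^sub>C b)"
    by (simp add: x(5) clinear_add[OF I_fun_clinear] clinear_scaleC[OF I_fun_clinear] scaleC_simps
        mult.commute)
  ultimately show "H (c *\<^sub>C x) = Some (c *\<^sub>C u)"
    using op_linear_scaleC[OF Lm_linear x(1)] op_linear_scaleC[OF Am_linear x(2)]
      op_linear_scaleC[OF B_linear x(3)]
    unfolding H_Some_iff by blast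
qed

text \<open>Green's identity leaves the boundary form in P and Q. The condition
  \<open>P f = I\<^sup>* f\<close> makes it cancel against the contributions of
  \<open>I Q\<close>.\<close>

lemma H_symmetric:
  assumes \<mu>: "\<mu> \<in> \<rho> (L_op Lm B)" and f: "H f = Some u" and g: "H g = Some v"
  shows "cinner u g = cinner f v"
proof -
  obtain l a b where f: "Lm f = Some l" "Am f = Some a" "B f = Some b"
    "\<alpha> *\<^sub>C a + \<beta> *\<^sub>C b = I_adj f" "u = l + I_fun (\<gamma> *\<^sub>C a + \<delta> *\<^sub>C b)"
    using f unfolding H_Some_iff by metis
  obtain l' a' b' where g: "Lm g = Some l'" "Am g = Some a'" "B g = Some b'"
    "\<alpha> *\<^sub>C a' + \<beta> *\<^sub>C b' = I_adj g" "v = l' + I_fun (\<gamma> *\<^sub>C a' + \<delta> *\<^sub>C b')"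
    using g unfolding H_Some_iff by metis
  have "cinner f (I_fun \<phi>) = cinner (I_adj f) \<phi>" for \<phi>
    using I_fun_adjoint by (metis cinner_commute)
  then have "cinner u g - cinner f v = cinner l g - cinner f l' +
      (cinner (\<gamma> *\<^sub>C a + \<delta> *\<^sub>C b) (\<alpha> *\<^sub>C a' + \<beta> *\<^sub>C b') - cinner (\<alpha> *\<^sub>C a + \<beta> *\<^sub>C b) (\<gamma> *\<^sub>C a' + \<delta> *\<^sub>C b'))"
    unfolding f(4) g(4) by (simp add: f(5) g(5) cinner_add_left[of l] cinner_add_right[of f l'] I_fun_adjoint)
  also have "\<dots> = 0"
    using boundary_form[of a b a' b'] Green_identity[OF \<mu> f(1-3) g(1-3)] by algebra
  finally show ?thesis by simp
qed

section \<open>The boundary value problem with data for P\<close>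

lemma Lab_linear: "op_linear Lab"
  using Lab_self_adjoint by (simp add: self_adjoint_def)

text \<open>Brings both cases of \<open>aTb\<close> into one form; for \<open>\<alpha> = 0\<close>
  the vector \<open>t = 0\<close> is a placeholder for the absent value of the adjoint.\<close>

lemma ran_aTb_iff:
  "\<phi> \<in> ran (aTb \<alpha> \<beta> T) \<longleftrightarrow> (\<exists>\<psi> t. \<phi> = \<alpha> *\<^sub>C t + \<beta> *\<^sub>C \<psi> \<and> (\<alpha> = 0 \<and> t = 0 \<or> \<alpha> \<noteq> 0 \<and> adj T \<psi> = Some t))"
  by (auto simp: aTb_def ran_def op_add_Some_iff op_scale_Some_iff)

text \<open>The domain of \<open>Lab\<close> lies in the domains of \<open>Am\<close> and
  \<open>B\<close>, so the product is defined everywhere and its adjoint is meaningful.\<close>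

lemma QR_total:
  assumes r: "resolvent \<nu> Lab = (\<lambda>y. Some (r y))" "\<And>y. Lab (r y) = Some (\<nu> *\<^sub>C r y - y)"
  shows "(\<gamma> *\<^sub>o Am +\<^sub>o \<delta> *\<^sub>o B) \<circ>\<^sub>m resolvent \<nu> Lab = (\<lambda>y. Some (Q (r y)))"
proof
  fix y
  obtain a b where "Am (r y) = Some a" "B (r y) = Some b"
    using r(2)[of y] unfolding Lab_Some_iff by blast
  then show "((\<gamma> *\<^sub>o Am +\<^sub>o \<delta> *\<^sub>o B) \<circ>\<^sub>m resolvent \<nu> Lab) y = Some (Q (r y))"
    by (auto simp: r(1) map_comp_Some_iff op_add_Some_iff op_scale_Some_iff Q_eq)
qed

context
  fixes \<mu> assumes \<mu>: "\<mu> \<in> \<rho> (L_op Lm B)" and \<mu>ab: "\<mu> \<in> \<rho> Lab"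
begin

text \<open>This is the formula \<open>G\<^sup>\<alpha>\<^sup>\<beta> (\<alpha> T\<^sup>* + \<beta>) = G\<close>, which exhibits the adjoint in the definition of
  \<open>G\<^sup>\<alpha>\<^sup>\<beta>\<close> on all of the range to which it is restricted.\<close>

lemma adj_QR:
  assumes \<psi>: "\<alpha> = 0 \<and> t = 0 \<or> adj (T_op Lm Am B (cnj \<mu>)) \<psi> = Some t"
  shows "adj ((\<gamma> *\<^sub>o Am +\<^sub>o \<delta> *\<^sub>o B) \<circ>\<^sub>m resolvent (cnj \<mu>) Lab) (\<alpha> *\<^sub>C t + \<beta> *\<^sub>C \<psi>) = Some (G\<^sub>0 \<mu> \<psi>)"
proof -
  note \<mu>' = cnj_\<mu>[OF \<mu>]
  obtain r where r: "resolvent (cnj \<mu>) Lab = (\<lambda>y. Some (r y))" "\<And>y. Lab (r y) = Some (cnj \<mu> *\<^sub>C r y - y)"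
    using resolvent_setE[OF self_adjoint_resolvent[OF Lab_self_adjoint \<mu>ab] Lab_linear] by metis
  show ?thesis
    unfolding QR_total[OF r]
  proof (rule adj_SomeI[OF densely_defined_total])
    fix x u assume "Some (Q (r x)) = Some u"
    then have u: "u = Q (r x)" by simp
    obtain a b where g: "Lm (r x) = Some (cnj \<mu> *\<^sub>C r x - x)" "Am (r x) = Some a" "B (r x) = Some b"
      and P: "\<alpha> *\<^sub>C a + \<beta> *\<^sub>C b = 0"
      using r(2)[of x] unfolding Lab_Some_iff by blast
    obtain a\<^sub>0 where d: "L_op Lm B (r x - G\<^sub>0 (cnj \<mu>) b) = Some (cnj \<mu> *\<^sub>C r x - x - cnj \<mu> *\<^sub>C G\<^sub>0 (cnj \<mu>) b)"
      "Am (r x - G\<^sub>0 (cnj \<mu>) b) = Some a\<^sub>0" "T_op Lm Am B (cnj \<mu>) b = Some (a - a\<^sub>0)"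
      using L_op_decomposition[OF \<mu>' g] by metis
    have "cinner \<psi> a\<^sub>0 = cinner (G\<^sub>0 \<mu> \<psi>) x"
      using G\<^sub>0_adjoint[OF \<mu> d(1,2), of \<psi>] by (simp add: scaleC_diff_right)
    then have 1: "cinner x (G\<^sub>0 \<mu> \<psi>) = cinner a\<^sub>0 \<psi>"
      by (metis cinner_commute)
    \<comment> \<open>For \<open>\<alpha> = 0\<close> the condition P = 0 on \<open>r x\<close>
      forces \<open>b = 0\<close>, and both sides vanish; otherwise this is the defining relation of
      the adjoint of T.\<close>
    have bt: "cinner (a - a\<^sub>0) \<psi> = cinner b t"
      using \<psi>
    proof
      assume *: "\<alpha> = 0 \<and> t = 0"
      then have "\<beta> \<noteq> 0" using det by auto
      moreover have "\<beta> *\<^sub>C b = 0" using P * by simp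
      ultimately have "b = 0"
        using scaleC_scaleC[of "inverse \<beta>" \<beta> b] by simp
      then have "G\<^sub>0 (cnj \<mu>) b = 0"
        using G\<^sub>0_unique[OF \<mu>', of 0 0] op_linear_0[OF Lm_linear] op_linear_0[OF B_linear] by simp
      then have "a - a\<^sub>0 = 0"
        using d(3) op_linear_0[OF Am_linear] by (simp add: T_op_Some_iff[OF \<mu>'])
      then show ?thesis using * by simp
    next
      assume "adj (T_op Lm Am B (cnj \<mu>)) \<psi> = Some t"
      then show ?thesis
        by (rule adj_SomeD[OF T_dense[OF \<mu>'] _ d(3)])
    qed
    \<comment> \<open>In the boundary form of \<open>(a, b)\<close> with \<open>(t, \<psi>)\<close>
      the first product vanishes, as P is 0 on \<open>r x\<close>.\<close>
    have "cinner u (\<alpha> *\<^sub>C t + \<beta> *\<^sub>C \<psi>) = cinner a \<psi> - cinner b t"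
      using boundary_form[of a b t \<psi>] by (simp add: P u Q_eq[OF g(2,3)] algebra_simps)
    then show "cinner u (\<alpha> *\<^sub>C t + \<beta> *\<^sub>C \<psi>) = cinner x (G\<^sub>0 \<mu> \<psi>)"
      by (simp add: 1 cinner_diff_left flip: bt)
  qed
qed

lemma T_op_le: "T_op Lm Am B \<mu> \<psi> = Some t \<Longrightarrow> adj (T_op Lm Am B (cnj \<mu>)) \<psi> = Some t"
  using T_adj[OF cnj_\<mu>[OF \<mu>]] by (auto simp: map_le_def dest: bspec)

text \<open>The argument of \<open>Gab\<close> is the P value of
  \<open>G\<^sub>0 \<mu> \<psi>\<close>. So \<open>Gab\<close> recovers this solution of
  \<open>Lm f = \<mu> f\<close> from its P value, just as \<open>G\<^sub>0\<close> does from its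
  \<open>B\<close> value.\<close>

lemma Gab_T_op:
  assumes "T_op Lm Am B \<mu> \<psi> = Some t"
  shows "Gab \<mu> (\<alpha> *\<^sub>C t + \<beta> *\<^sub>C \<psi>) = Some (G\<^sub>0 \<mu> \<psi>)"
proof -
  have "adj (T_op Lm Am B (cnj \<mu>)) \<psi> = Some t"
    using assms by (rule T_op_le)
  moreover from this have "\<alpha> *\<^sub>C t + \<beta> *\<^sub>C \<psi> \<in> ran (aTb \<alpha> \<beta> (T_op Lm Am B (cnj \<mu>)))"
    unfolding ran_aTb_iff by (cases "\<alpha> = 0") auto
  ultimately show ?thesis
    using adj_QR by (simp add: G_ab_def)
qed

lemma Tab_T_op:
  assumes "T_op Lm Am B \<mu> \<psi> = Some t"
  shows "Tab \<mu> (\<alpha> *\<^sub>C t + \<beta> *\<^sub>C \<psi>) = Some (\<gamma> *\<^sub>C t + \<delta> *\<^sub>C \<psi>)"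
  using Gab_T_op[OF assms] assms Lm_G\<^sub>0[OF \<mu>, of \<psi>] B_G\<^sub>0[OF \<mu>, of \<psi>]
  by (auto simp: T_ab_def restrict_map_def map_comp_Some_iff op_add_Some_iff op_scale_Some_iff
      T_op_Some_iff[OF \<mu>])

text \<open>\<open>Gab\<close> at \<open>\<phi>\<close> is some
  \<open>G\<^sub>0 \<mu> \<psi>\<close>, and the requirement that it lie in the domain of
  \<open>Am\<close> says that \<open>\<psi>\<close> lies in the domain of T.\<close>

lemma Tab_SomeE:
  assumes "Tab \<mu> \<phi> = Some \<tau>"
  obtains \<psi> t where "T_op Lm Am B \<mu> \<psi> = Some t" "\<phi> = \<alpha> *\<^sub>C t + \<beta> *\<^sub>C \<psi>" "\<tau> = \<gamma> *\<^sub>C t + \<delta> *\<^sub>C \<psi>"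
proof -
  obtain w a where w: "Gab \<mu> \<phi> = Some w" "Am w = Some a"
    using assms by (fastforce simp: T_ab_def restrict_map_def split: if_splits)
  then obtain \<psi> t' where \<psi>: "\<phi> = \<alpha> *\<^sub>C t' + \<beta> *\<^sub>C \<psi>"
    "\<alpha> = 0 \<and> t' = 0 \<or> \<alpha> \<noteq> 0 \<and> adj (T_op Lm Am B (cnj \<mu>)) \<psi> = Some t'"
    unfolding G_ab_def restrict_map_def using ran_aTb_iff by (metis option.distinct(1))
  then have "w = G\<^sub>0 \<mu> \<psi>"
    using w(1) adj_QR[of t' \<psi>] by (auto simp: G_ab_def restrict_map_def split: if_splits)
  then obtain t where t: "T_op Lm Am B \<mu> \<psi> = Some t"
    using w(2) by (auto simp: T_op_Some_iff[OF \<mu>])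
  \<comment> \<open>\<open>t\<close> equals \<open>t'\<close> because T is contained in the adjoint;
    for \<open>\<alpha> = 0\<close> both drop out.\<close>
  have "\<phi> = \<alpha> *\<^sub>C t + \<beta> *\<^sub>C \<psi>"
    using \<psi> T_op_le[OF t] by auto
  then show ?thesis
    using that t Tab_T_op[OF t] assms by simp
qed

lemma H_Some_iff_Gab:
  "H f = Some k \<longleftrightarrow> (\<exists>h l \<tau>. Gab \<mu> (I_adj f) = Some (f - h) \<and> Lab h = Some l \<and>
     Tab \<mu> (I_adj f) = Some \<tau> \<and> k = \<mu> *\<^sub>C f + (l - \<mu> *\<^sub>C h + I_fun (Q h)) + I_fun \<tau>)"
proof
  assume "H f = Some k"
  then obtain l a b where f: "Lm f = Some l" "Am f = Some a" "B f = Some b"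
    "\<alpha> *\<^sub>C a + \<beta> *\<^sub>C b = I_adj f" "k = l + I_fun (\<gamma> *\<^sub>C a + \<delta> *\<^sub>C b)"
    unfolding H_Some_iff by metis
  obtain r where r: "\<And>y. Lab (r y) = Some (\<mu> *\<^sub>C r y - y)"
    using resolvent_setE[OF \<mu>ab Lab_linear] by metis
  \<comment> \<open>Chosen so that \<open>(Lm - \<mu>) h = (Lm - \<mu>) f\<close> and P vanishes on
    \<open>h\<close>; then \<open>f - h\<close> solves the homogeneous equation and has the same P
    value as \<open>f\<close>.\<close>
  define h where "h = r (\<mu> *\<^sub>C f - l)"
  have Lh: "Lab h = Some (\<mu> *\<^sub>C h - (\<mu> *\<^sub>C f - l))"
    unfolding h_def by (rule r)
  then obtain a' b' where h: "Lm h = Some (\<mu> *\<^sub>C h - (\<mu> *\<^sub>C f - l))" "Am h = Some a'" "B h = Some b'"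
    "\<alpha> *\<^sub>C a' + \<beta> *\<^sub>C b' = 0"
    unfolding Lab_Some_iff by blast
  have "Lm (f - h) = Some (\<mu> *\<^sub>C (f - h))"
    using op_linear_diff[OF Lm_linear f(1) h(1)] by (simp add: scaleC_simps)
  then have G: "f - h = G\<^sub>0 \<mu> (b - b')"
    using op_linear_diff[OF B_linear f(3) h(3)] by (rule G\<^sub>0_unique[OF \<mu>])
  have T: "T_op Lm Am B \<mu> (b - b') = Some (a - a')"
    using op_linear_diff[OF Am_linear f(2) h(2)] by (simp add: T_op_Some_iff[OF \<mu>] G)
  have P: "\<alpha> *\<^sub>C (a - a') + \<beta> *\<^sub>C (b - b') = I_adj f"
    using h(4) f(4) by (simp add: scaleC_diff_right algebra_simps)
  have "k = \<mu> *\<^sub>C f + ((\<mu> *\<^sub>C h - (\<mu> *\<^sub>C f - l)) - \<mu> *\<^sub>C h + I_fun (Q h)) +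
      I_fun (\<gamma> *\<^sub>C (a - a') + \<delta> *\<^sub>C (b - b'))"
    unfolding f(5) Q_eq[OF h(2,3)]
    by (simp add: clinear_add[OF I_fun_clinear] clinear_diff[OF I_fun_clinear] scaleC_diff_right)
  then show "\<exists>h l \<tau>. Gab \<mu> (I_adj f) = Some (f - h) \<and> Lab h = Some l \<and>
     Tab \<mu> (I_adj f) = Some \<tau> \<and> k = \<mu> *\<^sub>C f + (l - \<mu> *\<^sub>C h + I_fun (Q h)) + I_fun \<tau>"
    using Lh Gab_T_op[OF T] Tab_T_op[OF T] unfolding P G[symmetric] by blast
next
  assume "\<exists>h l \<tau>. Gab \<mu> (I_adj f) = Some (f - h) \<and> Lab h = Some l \<and>
     Tab \<mu> (I_adj f) = Some \<tau> \<and> k = \<mu> *\<^sub>C f + (l - \<mu> *\<^sub>C h + I_fun (Q h)) + I_fun \<tau>"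
  then obtain h l \<tau> where G: "Gab \<mu> (I_adj f) = Some (f - h)" and Lh: "Lab h = Some l"
    and T: "Tab \<mu> (I_adj f) = Some \<tau>" and k: "k = \<mu> *\<^sub>C f + (l - \<mu> *\<^sub>C h + I_fun (Q h)) + I_fun \<tau>"
    by blast
  obtain a b where h: "Lm h = Some l" "Am h = Some a" "B h = Some b" "\<alpha> *\<^sub>C a + \<beta> *\<^sub>C b = 0"
    using Lh unfolding Lab_Some_iff by blast
  obtain \<psi> t where \<psi>: "T_op Lm Am B \<mu> \<psi> = Some t" "I_adj f = \<alpha> *\<^sub>C t + \<beta> *\<^sub>C \<psi>"
    "\<tau> = \<gamma> *\<^sub>C t + \<delta> *\<^sub>C \<psi>"
    using Tab_SomeE[OF T] by metis
  have f: "f = G\<^sub>0 \<mu> \<psi> + h"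
    using Gab_T_op[OF \<psi>(1)] G \<psi>(2) by simp
  have "Lm f = Some (\<mu> *\<^sub>C G\<^sub>0 \<mu> \<psi> + l)" "Am f = Some (t + a)" "B f = Some (\<psi> + b)"
    using \<psi>(1) op_linear_add[OF Lm_linear Lm_G\<^sub>0[OF \<mu>] h(1)] op_linear_add[OF B_linear B_G\<^sub>0[OF \<mu>] h(3)]
      op_linear_add[OF Am_linear _ h(2)] by (auto simp: f T_op_Some_iff[OF \<mu>])
  moreover have "\<alpha> *\<^sub>C (t + a) + \<beta> *\<^sub>C (\<psi> + b) = (\<alpha> *\<^sub>C t + \<beta> *\<^sub>C \<psi>) + (\<alpha> *\<^sub>C a + \<beta> *\<^sub>C b)"
    by (simp add: scaleC_simps)
  then have "\<alpha> *\<^sub>C (t + a) + \<beta> *\<^sub>C (\<psi> + b) = I_adj f"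
    by (simp add: h(4) \<psi>(2))
  moreover have "k = (\<mu> *\<^sub>C G\<^sub>0 \<mu> \<psi> + l) + I_fun (\<gamma> *\<^sub>C (t + a) + \<delta> *\<^sub>C (\<psi> + b))"
    by (simp add: k \<psi>(3) f Q_eq[OF h(2,3)] clinear_add[OF I_fun_clinear] scaleC_simps)
  ultimately show "H f = Some k"
    unfolding H_Some_iff by blast
qed

lemma Gab_linear: "op_linear (Gab \<mu>)"
proof -
  note \<mu>' = cnj_\<mu>[OF \<mu>]
  obtain r where r: "resolvent (cnj \<mu>) Lab = (\<lambda>y. Some (r y))" "\<And>y. Lab (r y) = Some (cnj \<mu> *\<^sub>C r y - y)"
    using resolvent_setE[OF self_adjoint_resolvent[OF Lab_self_adjoint \<mu>ab] Lab_linear] by metis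
  have "op_linear (aTb \<alpha> \<beta> (T_op Lm Am B (cnj \<mu>)))"
    using op_linear_adj[OF T_dense[OF \<mu>']]
    by (simp add: aTb_def op_linear_op_add op_linear_op_scale op_linear_Some)
  then show ?thesis
    unfolding G_ab_def QR_total[OF r]
    by (intro op_linear_restrict_ran op_linear_adj densely_defined_total)
qed

lemma Gab_adjoint:
  assumes r: "resolvent (cnj \<mu>) Lab = (\<lambda>y. Some (r y))" "\<And>y. Lab (r y) = Some (cnj \<mu> *\<^sub>C r y - y)"
    and w: "Gab \<mu> \<phi> = Some w"
  shows "cinner (Q (r y)) \<phi> = cinner y w"
proof -
  have "adj (\<lambda>y. Some (Q (r y))) \<phi> = Some w"
    using w unfolding G_ab_def QR_total[OF r] by (simp add: restrict_map_def split: if_splits)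
  then show ?thesis
    by (rule adj_SomeD[OF densely_defined_total]) simp
qed

end

end

section \<open>The operator with interior-boundary condition\<close>

context ibc_robin
begin

definition R :: "complex \<Rightarrow> 'h \<Rightarrow> 'h" where "R \<mu> y = the (resolvent \<mu> Lab y)"

definition X :: "complex \<Rightarrow> 'h \<rightharpoonup> 'h" where "X \<mu> = Some -\<^sub>o (Gab \<mu> \<circ>\<^sub>m adj I)"

definition \<Gamma> :: "complex \<Rightarrow> 'h \<Rightarrow> 'h" where "\<Gamma> \<mu> y = the (resolvent 1 (Gab \<mu> \<circ>\<^sub>m adj I) y)"

definition \<Gamma>' :: "complex \<Rightarrow> 'h \<Rightarrow> 'h" where "\<Gamma>' \<mu> y = the (adj (resolvent 1 (Gab \<mu> \<circ>\<^sub>m adj I)) y)"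

text \<open>An explicit formula for the adjoint of \<open>X (cnj \<mu>)\<close>, suggested by
  \<open>G = (Q R)\<^sup>*\<close>. In contrast, \<open>\<Gamma>' \<mu>\<close> is the adjoint of
  \<open>\<Gamma> \<mu>\<close>, so the inverse of \<open>X' \<mu>\<close> is
  \<open>\<Gamma>' (cnj \<mu>)\<close>.\<close>

definition X' :: "complex \<Rightarrow> 'h \<Rightarrow> 'h" where "X' \<mu> y = y - I_fun (Q (R \<mu> y))"

definition V :: "complex \<Rightarrow> 'h \<rightharpoonup> 'h" where "V \<mu> = I \<circ>\<^sub>m Tab \<mu> \<circ>\<^sub>m adj I"

definition S :: "complex \<Rightarrow> 'h \<rightharpoonup> 'h" where
  "S \<mu> = adj (X (cnj \<mu>)) \<circ>\<^sub>m (Lab -\<^sub>o \<mu> *\<^sub>o Some) \<circ>\<^sub>m X \<mu>"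

definition admissible :: "complex \<Rightarrow> bool" where
  "admissible \<mu> \<longleftrightarrow> \<mu> \<in> \<rho> (L_op Lm B) \<and> \<mu> \<in> \<rho> Lab \<and>
     1 \<in> \<rho> (Gab \<mu> \<circ>\<^sub>m adj I) \<and> 1 \<in> \<rho> (Gab (cnj \<mu>) \<circ>\<^sub>m adj I)"

lemma admissible_cnj: "admissible \<mu> \<Longrightarrow> admissible (cnj \<mu>)"
  unfolding admissible_def complex_cnj_cnj
  by (blast intro: self_adjoint_resolvent[OF L_self_adjoint] self_adjoint_resolvent[OF Lab_self_adjoint])

lemma X_Some_iff: "X \<mu> f = Some h \<longleftrightarrow> Gab \<mu> (I_adj f) = Some (f - h)"
  by (auto simp: X_def op_diff_Some_iff map_comp_Some_iff adj_I_eq)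

context
  fixes \<mu> assumes \<mu>: "admissible \<mu>"
begin

lemma admissibleD:
  "\<mu> \<in> \<rho> (L_op Lm B)" "\<mu> \<in> \<rho> Lab" "1 \<in> \<rho> (Gab \<mu> \<circ>\<^sub>m adj I)"
  "cnj \<mu> \<in> \<rho> (L_op Lm B)" "cnj \<mu> \<in> \<rho> Lab"
  using \<mu> admissible_cnj[OF \<mu>] unfolding admissible_def by simp_all

lemma R:
  shows R_eq: "resolvent \<mu> Lab = (\<lambda>y. Some (R \<mu> y))"
    and Lab_R: "Lab (R \<mu> y) = Some (\<mu> *\<^sub>C R \<mu> y - y)"
    and R_Lab: "Lab h = Some l \<Longrightarrow> R \<mu> (\<mu> *\<^sub>C h - l) = h"
    and R_clinear: "clinear (R \<mu>)" and R_cbounded: "cbounded (R \<mu>)"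
proof -
  obtain r where r: "resolvent \<mu> Lab = (\<lambda>y. Some (r y))" "\<And>y. Lab (r y) = Some (\<mu> *\<^sub>C r y - y)"
    "\<And>x u. Lab x = Some u \<Longrightarrow> r (\<mu> *\<^sub>C x - u) = x" "clinear r" "cbounded r"
    using resolvent_setE[OF admissibleD(2) Lab_linear] by metis
  have "R \<mu> = r"
    by (simp add: fun_eq_iff R_def r(1))
  then show "resolvent \<mu> Lab = (\<lambda>y. Some (R \<mu> y))" "Lab (R \<mu> y) = Some (\<mu> *\<^sub>C R \<mu> y - y)"
    "Lab h = Some l \<Longrightarrow> R \<mu> (\<mu> *\<^sub>C h - l) = h" "clinear (R \<mu>)" "cbounded (R \<mu>)"
    by (simp_all only: r)
qed

lemma \<Gamma>:
  shows \<Gamma>_eq: "resolvent 1 (Gab \<mu> \<circ>\<^sub>m adj I) = (\<lambda>y. Some (\<Gamma> \<mu> y))"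
    and X_\<Gamma>: "X \<mu> (\<Gamma> \<mu> y) = Some y"
    and \<Gamma>_X: "X \<mu> x = Some y \<Longrightarrow> \<Gamma> \<mu> y = x"
    and \<Gamma>_clinear: "clinear (\<Gamma> \<mu>)" and \<Gamma>_cbounded: "cbounded (\<Gamma> \<mu>)"
    and X_dense: "densely_defined (X \<mu>)"
proof -
  let ?U = "Gab \<mu> \<circ>\<^sub>m adj I"
  have I: "adj I = (\<lambda>f. Some (I_adj f))"
    by (simp add: fun_eq_iff adj_I_eq)
  have lin: "op_linear ?U"
    unfolding I by (intro op_linear_comp Gab_linear admissibleD) (simp add: op_linear_total I_adj_clinear)
  obtain g where g: "resolvent 1 ?U = (\<lambda>y. Some (g y))" "\<And>y. ?U (g y) = Some (1 *\<^sub>C g y - y)"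
    "\<And>x u. ?U x = Some u \<Longrightarrow> g (1 *\<^sub>C x - u) = x" "clinear g" "cbounded g"
    by (rule resolvent_setE[OF admissibleD(3) lin]) (rule that; assumption)
  have X: "X \<mu> x = Some y \<longleftrightarrow> ?U x = Some (x - y)" for x y
    by (auto simp: X_Some_iff map_comp_Some_iff adj_I_eq)
  have "\<Gamma> \<mu> = g"
    by (simp add: fun_eq_iff \<Gamma>_def g(1))
  then show "resolvent 1 ?U = (\<lambda>y. Some (\<Gamma> \<mu> y))" "clinear (\<Gamma> \<mu>)" "cbounded (\<Gamma> \<mu>)"
    by (simp_all only: g)
  show "X \<mu> (\<Gamma> \<mu> y) = Some y"
    using g(2)[of y] by (simp only: \<open>\<Gamma> \<mu> = g\<close> X scaleC_one)
  show "\<Gamma> \<mu> y = x" if "X \<mu> x = Some y"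
    using g(3)[of x "x - y"] that by (simp add: \<open>\<Gamma> \<mu> = g\<close> X)
  have "dom (X \<mu>) = dom ?U"
    by (auto simp: X_def op_diff_def dom_def)
  then show "densely_defined (X \<mu>)"
    using admissibleD(3) by (simp add: resolvent_set_def densely_defined_def)
qed

lemma \<Gamma>':
  shows adj_\<Gamma>_eq: "adj (resolvent 1 (Gab \<mu> \<circ>\<^sub>m adj I)) = (\<lambda>y. Some (\<Gamma>' \<mu> y))"
    and \<Gamma>_adjoint: "cinner (\<Gamma> \<mu> x) y = cinner x (\<Gamma>' \<mu> y)"
    and \<Gamma>'_clinear: "clinear (\<Gamma>' \<mu>)" and \<Gamma>'_cbounded: "cbounded (\<Gamma>' \<mu>)"
proof -
  obtain g where g: "clinear g" "cbounded g" "\<And>x y. cinner (\<Gamma> \<mu> x) y = cinner x (g y)"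
    using bounded_adjoint[OF \<Gamma>_clinear \<Gamma>_cbounded] by metis
  have adj: "adj (resolvent 1 (Gab \<mu> \<circ>\<^sub>m adj I)) = (\<lambda>y. Some (g y))"
    unfolding \<Gamma>_eq by (rule adj_total) (rule g(3))
  have "\<Gamma>' \<mu> = g"
    by (simp add: fun_eq_iff \<Gamma>'_def adj)
  then show "adj (resolvent 1 (Gab \<mu> \<circ>\<^sub>m adj I)) = (\<lambda>y. Some (\<Gamma>' \<mu> y))"
    "cinner (\<Gamma> \<mu> x) y = cinner x (\<Gamma>' \<mu> y)" "clinear (\<Gamma>' \<mu>)" "cbounded (\<Gamma>' \<mu>)"
    by (simp_all only: g adj)
qed

lemma \<Gamma>R_inj:
  assumes "\<Gamma> \<mu> (R \<mu> x) = \<Gamma> \<mu> (R \<mu> y)" shows "x = y"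
proof -
  have R: "R \<mu> x = R \<mu> y"
    using trans[OF X_\<Gamma>[of "R \<mu> x", symmetric, unfolded assms] X_\<Gamma>[of "R \<mu> y"]] by simp
  show ?thesis
    using trans[OF Lab_R[of x, symmetric, unfolded R] Lab_R[of y]] by simp
qed

lemma Q_minus:
  assumes "Lab h = Some l" shows "Q (- h) = - Q h"
proof -
  obtain a b where "Am h = Some a" "B h = Some b"
    using assms unfolding Lab_Some_iff by blast
  then show ?thesis
    using op_linear_minus[OF Am_linear] op_linear_minus[OF B_linear] by (simp add: Q_eq)
qed

text \<open>The range of \<open>R \<mu>\<close> is the dense domain of \<open>Lab\<close>, so by
  continuity of \<open>\<Gamma> \<mu>\<close> the closure contains the range of
  \<open>\<Gamma> \<mu>\<close> and with it the dense domain of \<open>X \<mu>\<close>. This will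
  give density of the domain of \<open>H\<close>.\<close>

lemma closure_\<Gamma>R: "closure (range (\<lambda>y. \<Gamma> \<mu> (R \<mu> y))) = UNIV"
proof -
  have cont: "continuous_on UNIV (\<Gamma> \<mu>)"
  proof -
    obtain K where "\<And>x. norm (\<Gamma> \<mu> x) \<le> K * norm x"
      using cboundedE[OF \<Gamma>_cbounded] by metis
    then have "bounded_linear (\<Gamma> \<mu>)"
      using clinear_imp_linear[OF \<Gamma>_clinear]
      by (intro bounded_linear_intro[where K=K]) (auto simp: linear_add linear_scale mult.commute)
    then show ?thesis by (rule linear_continuous_on)
  qed
  have "range (R \<mu>) = dom Lab"
    using Lab_R R_Lab by (auto simp: image_iff) (metis)
  then have "closure (range (R \<mu>)) = UNIV"
    using Lab_self_adjoint by (simp add: self_adjoint_def densely_defined_def)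
  then have "range (\<Gamma> \<mu>) \<subseteq> closure (\<Gamma> \<mu> ` range (R \<mu>))"
    using continuous_on_subset[OF cont] image_closure_subset[of "range (R \<mu>)" "\<Gamma> \<mu>"]
    by (metis closed_closure closure_subset subset_UNIV)
  moreover have "dom (X \<mu>) \<subseteq> range (\<Gamma> \<mu>)"
    using \<Gamma>_X by blast
  ultimately have "closure (dom (X \<mu>)) \<subseteq> closure (\<Gamma> \<mu> ` range (R \<mu>))"
    by (meson closure_minimal closed_closure order_trans)
  then show ?thesis
    using X_dense by (auto simp: densely_defined_def image_image)
qed

end

text \<open>The duality between \<open>Gab\<close> and \<open>Q R\<close> shows that the adjoint of
  \<open>X (cnj \<mu>)\<close> is defined everywhere. Boundedness of \<open>X' \<mu>\<close>, and
  thus of \<open>I Q R\<close>, then comes from the Hellinger--Toeplitz argument in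
  \<open>adjoint_of_inverse\<close>.\<close>

lemma X':
  assumes \<mu>: "admissible \<mu>"
  shows adj_X: "adj (X (cnj \<mu>)) = (\<lambda>y. Some (X' \<mu> y))"
    and \<Gamma>'_X': "\<Gamma>' (cnj \<mu>) (X' \<mu> y) = y" and X'_\<Gamma>': "X' \<mu> (\<Gamma>' (cnj \<mu>) y) = y"
    and X'_clinear: "clinear (X' \<mu>)" and X'_cbounded: "cbounded (X' \<mu>)"
proof -
  note \<mu>' = admissible_cnj[OF \<mu>]
  show adj: "adj (X (cnj \<mu>)) = (\<lambda>y. Some (X' \<mu> y))"
  proof (intro ext adj_SomeI[OF X_dense[OF \<mu>']])
    fix y u v assume "X (cnj \<mu>) u = Some v"
    then have "Gab (cnj \<mu>) (I_adj u) = Some (u - v)"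
      by (simp add: X_Some_iff)
    then have "cinner (Q (R \<mu> y)) (I_adj u) = cinner y (u - v)"
      using R_eq[OF \<mu>] Lab_R[OF \<mu>] Gab_adjoint[OF admissibleD(4,5)[OF \<mu>], of "R \<mu>"] by simp
    then have "cinner (I_fun (Q (R \<mu> y))) u = cinner y (u - v)"
      by (simp add: I_fun_adjoint)
    then have "cinner u (I_fun (Q (R \<mu> y))) = cinner (u - v) y"
      by (metis cinner_commute)
    then show "cinner v y = cinner u (X' \<mu> y)"
      by (simp add: X'_def cinner_diff_right cinner_diff_left)
  qed
  show "\<Gamma>' (cnj \<mu>) (X' \<mu> y) = y" "X' \<mu> (\<Gamma>' (cnj \<mu>) y) = y" "cbounded (X' \<mu>)" "clinear (X' \<mu>)"
    by (rule adjoint_of_inverse[OF X_dense[OF \<mu>'] X_\<Gamma>[OF \<mu>'] \<Gamma>_X[OF \<mu>'] \<Gamma>_adjoint[OF \<mu>'] adj];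
        assumption)+
qed

section \<open>The splitting of H into S and V\<close>

lemma S_Some_iff:
  assumes \<mu>: "admissible \<mu>"
  shows "S \<mu> f = Some s \<longleftrightarrow> (\<exists>h l. X \<mu> f = Some h \<and> Lab h = Some l \<and> s = X' \<mu> (l - \<mu> *\<^sub>C h))"
  by (auto simp: S_def map_comp_Some_iff adj_X[OF \<mu>] op_diff_Some_iff op_scale_Some_iff)

text \<open>\<open>R \<mu>\<close> inverts \<open>\<mu> - Lab\<close>, hence the change of sign. The
  right-hand side is the bracket in \<open>H_Some_iff_Gab\<close>, which thereby becomes a value of
  \<open>S\<close>.\<close>

lemma X'_Lab:
  assumes \<mu>: "admissible \<mu>" and h: "Lab h = Some l"
  shows "X' \<mu> (l - \<mu> *\<^sub>C h) = l - \<mu> *\<^sub>C h + I_fun (Q h)"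
proof -
  have "R \<mu> (l - \<mu> *\<^sub>C h) = - h"
    using R_Lab[OF \<mu> h] clinear_minus[OF R_clinear[OF \<mu>], of "\<mu> *\<^sub>C h - l"] by simp
  then show ?thesis
    by (simp add: X'_def Q_minus[OF \<mu> h] clinear_minus[OF I_fun_clinear])
qed

text \<open>An identity of operators including domains: the domain of \<open>H\<close> is the
  intersection of those of \<open>S\<close> and \<open>V\<close>.\<close>

lemma H_Some_iff_S:
  assumes \<mu>: "admissible \<mu>"
  shows "H f = Some k \<longleftrightarrow> (\<exists>s v. S \<mu> f = Some s \<and> V \<mu> f = Some v \<and> k = \<mu> *\<^sub>C f + s + v)"
proof -
  have "V \<mu> f = Some v \<longleftrightarrow> (\<exists>\<tau>. Tab \<mu> (I_adj f) = Some \<tau> \<and> v = I_fun \<tau>)" for v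
    by (auto simp: V_def map_comp_Some_iff I_eq adj_I_eq)
  then show ?thesis
    by (auto simp: H_Some_iff_Gab[OF admissibleD(1,2)[OF \<mu>]] S_Some_iff[OF \<mu>] X_Some_iff X'_Lab[OF \<mu>])
qed

lemma S_\<Gamma>R:
  assumes \<mu>: "admissible \<mu>"
  shows "S \<mu> (\<Gamma> \<mu> (R \<mu> y)) = Some (- X' \<mu> y)"
  using X_\<Gamma>[OF \<mu>, of "R \<mu> y"] Lab_R[OF \<mu>, of y]
  by (simp add: S_Some_iff[OF \<mu>] clinear_minus[OF X'_clinear[OF \<mu>]])

definition v :: "complex \<Rightarrow> 'h \<Rightarrow> 'h" where "v \<mu> y = the (V \<mu> (\<Gamma> \<mu> (R \<mu> y)))"

text \<open>The vectors \<open>\<Gamma> \<mu> (R \<mu> y)\<close> exhaust the domain of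
  \<open>S\<close>, and relative boundedness includes that domain in the domain of \<open>V\<close>.
  They therefore parametrize the domain of \<open>H\<close>.\<close>

lemma H_\<Gamma>R:
  assumes \<mu>: "admissible \<mu>" and rel: "rel_bounded a (V \<mu>) (S \<mu>)"
  shows V_\<Gamma>R: "V \<mu> (\<Gamma> \<mu> (R \<mu> y)) = Some (v \<mu> y)"
    and H_\<Gamma>R_eq: "H (\<Gamma> \<mu> (R \<mu> y)) = Some (\<mu> *\<^sub>C \<Gamma> \<mu> (R \<mu> y) - X' \<mu> y + v \<mu> y)"
    and dom_H: "dom H = range (\<lambda>y. \<Gamma> \<mu> (R \<mu> y))"
    and v_bound: "\<exists>b\<ge>0. \<forall>y. norm (v \<mu> y) \<le> a * norm (X' \<mu> y) + b * norm (\<Gamma> \<mu> (R \<mu> y))"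
proof -
  have V: "V \<mu> (\<Gamma> \<mu> (R \<mu> y)) = Some (v \<mu> y)" for y
  proof -
    have "\<Gamma> \<mu> (R \<mu> y) \<in> dom (V \<mu>)"
      using rel S_\<Gamma>R[OF \<mu>, of y] unfolding rel_bounded_def by blast
    then show ?thesis by (auto simp: v_def)
  qed
  have H: "H (\<Gamma> \<mu> (R \<mu> y)) = Some (\<mu> *\<^sub>C \<Gamma> \<mu> (R \<mu> y) - X' \<mu> y + v \<mu> y)" for y
    unfolding H_Some_iff_S[OF \<mu>] by (auto simp: S_\<Gamma>R[OF \<mu>] V)
  show "V \<mu> (\<Gamma> \<mu> (R \<mu> y)) = Some (v \<mu> y)"
    "H (\<Gamma> \<mu> (R \<mu> y)) = Some (\<mu> *\<^sub>C \<Gamma> \<mu> (R \<mu> y) - X' \<mu> y + v \<mu> y)"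
    by (fact V H)+
  have "\<exists>y. f = \<Gamma> \<mu> (R \<mu> y)" if f: "H f = Some k" for f k
  proof -
    obtain h l where "X \<mu> f = Some h" "Lab h = Some l"
      using f unfolding H_Some_iff_S[OF \<mu>] S_Some_iff[OF \<mu>] by blast
    then have "f = \<Gamma> \<mu> (R \<mu> (\<mu> *\<^sub>C h - l))"
      by (simp add: R_Lab[OF \<mu>] \<Gamma>_X[OF \<mu>])
    then show ?thesis ..
  qed
  then show "dom H = range (\<lambda>y. \<Gamma> \<mu> (R \<mu> y))"
    using H by blast
  obtain b where b: "0 \<le> b" "\<And>f. f \<in> dom (S \<mu>) \<Longrightarrow> norm (the (V \<mu> f)) \<le> a * norm (the (S \<mu> f)) + b * norm f"
    using rel unfolding rel_bounded_def by blast
  have "norm (v \<mu> y) \<le> a * norm (X' \<mu> y) + b * norm (\<Gamma> \<mu> (R \<mu> y))" for y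
    using b(2)[of "\<Gamma> \<mu> (R \<mu> y)"] S_\<Gamma>R[OF \<mu>, of y] by (simp add: dom_def V)
  then show "\<exists>b\<ge>0. \<forall>y. norm (v \<mu> y) \<le> a * norm (X' \<mu> y) + b * norm (\<Gamma> \<mu> (R \<mu> y))"
    using b(1) by blast
qed

text \<open>In the formula for \<open>H\<close> on \<open>\<Gamma> R\<close> all other terms are
  linear in \<open>y\<close>, hence so is \<open>v\<close>.\<close>

lemma v_clinear:
  assumes \<mu>: "admissible \<mu>" and rel: "rel_bounded a (V \<mu>) (S \<mu>)"
  shows "clinear (v \<mu>)"
proof -
  define F where "F y = \<Gamma> \<mu> (R \<mu> y)" for y
  have F: "clinear F"
    unfolding F_def by (rule clinear_compose[OF \<Gamma>_clinear[OF \<mu>] R_clinear[OF \<mu>]])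
  have HF: "H (F y) = Some (\<mu> *\<^sub>C F y - X' \<mu> y + v \<mu> y)" for y
    unfolding F_def by (rule H_\<Gamma>R_eq[OF \<mu> rel])
  have "v \<mu> (x + y) = v \<mu> x + v \<mu> y" for x y
    using op_linear_add[OF H_linear HF[of x] HF[of y]] HF[of "x + y"]
    by (simp add: clinear_add[OF F] clinear_add[OF X'_clinear[OF \<mu>]] scaleC_add_right algebra_simps)
  moreover have "v \<mu> (c *\<^sub>C x) = c *\<^sub>C v \<mu> x" for c x
    using op_linear_scaleC[OF H_linear HF[of x], of c] HF[of "c *\<^sub>C x"]
    by (simp add: clinear_scaleC[OF F] clinear_scaleC[OF X'_clinear[OF \<mu>]] scaleC_simps
        mult.commute[of c])
  ultimately show ?thesis by (simp add: clinear_def)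
qed

section \<open>Self-adjointness of H\<close>

theorem H_self_adjoint:
  assumes z: "admissible z" and a: "a < 1" "rel_bounded a (V z) (S z)"
    and a': "a' < 1" "rel_bounded a' (V (cnj z)) (S (cnj z))"
  shows "self_adjoint H"
proof -
  \<comment> \<open>The inverse of \<open>S \<mu>\<close>; the sign arises because
    \<open>R \<mu>\<close> inverts \<open>\<mu> - Lab\<close> while \<open>S\<close> contains
    \<open>Lab - \<mu>\<close>.\<close>
  define W where "W \<mu> y = - \<Gamma> \<mu> (R \<mu> (\<Gamma>' (cnj \<mu>) y))" for \<mu> y
  note z' = admissible_cnj[OF z]
  have W: "clinear (W \<mu>)" "cbounded (W \<mu>)" if "admissible \<mu>" for \<mu>
    unfolding W_def
    using clinear_uminus[OF clinear_compose[OF \<Gamma>_clinear[OF that] clinear_compose[OF R_clinear[OF that]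
          \<Gamma>'_clinear[OF admissible_cnj[OF that]]]]]
      cbounded_uminus[OF cbounded_compose[OF \<Gamma>_cbounded[OF that] cbounded_compose[OF R_cbounded[OF that]
          \<Gamma>'_cbounded[OF admissible_cnj[OF that]]]]] .
  have HW: "H (W \<mu> y) = Some (\<mu> *\<^sub>C W \<mu> y + y + - v \<mu> (\<Gamma>' (cnj \<mu>) y))"
    if "admissible \<mu>" "rel_bounded c (V \<mu>) (S \<mu>)" for \<mu> c y
    using op_linear_minus[OF H_linear H_\<Gamma>R_eq[OF that, of "\<Gamma>' (cnj \<mu>) y"]]
    by (simp add: W_def X'_\<Gamma>'[OF that(1)])
  have bound: "\<exists>b. \<forall>y. norm (- v \<mu> (\<Gamma>' (cnj \<mu>) y)) \<le> c * norm y + b * norm (W \<mu> y)"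
    if "admissible \<mu>" "rel_bounded c (V \<mu>) (S \<mu>)" for \<mu> c
    using v_bound[OF that] by (simp add: W_def) (metis X'_\<Gamma>'[OF that(1)])
  obtain b where b: "\<And>y. norm (- v z (\<Gamma>' (cnj z) y)) \<le> a * norm y + b * norm (W z y)"
    using bound[OF z a(2)] by blast
  obtain b' where b': "\<And>y. norm (- v (cnj z) (\<Gamma>' (cnj (cnj z)) y)) \<le> a' * norm y + b' * norm (W (cnj z) y)"
    using bound[OF z' a'(2)] by blast
  \<comment> \<open>Taking adjoints reverses the three factors and conjugates the parameter of
    each.\<close>
  have adjoint: "cinner (W z x) y = cinner x (W (cnj z) y)" for x y
  proof -
    have RR: "cinner (R z x) y = cinner x (R (cnj z) y)" for x y
      by (rule self_adjoint_resolvents[OF Lab_self_adjoint Lab_R[OF z] Lab_R[OF z']])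
    have \<Gamma>\<Gamma>: "cinner (\<Gamma>' (cnj z) x) y = cinner x (\<Gamma> (cnj z) y)" for x y
      using \<Gamma>_adjoint[OF z'] by (metis cinner_commute)
    show ?thesis
      by (simp add: W_def \<Gamma>_adjoint[OF z] RR \<Gamma>\<Gamma>)
  qed
  have dense: "densely_defined H"
    using closure_\<Gamma>R[OF z] dom_H[OF z a(2)] by (simp add: densely_defined_def)
  show ?thesis
    by (rule self_adjoint_perturbation[OF H_linear dense H_symmetric[OF admissibleD(1)[OF z]]
          W[OF z] W[OF z'] adjoint HW[OF z a(2)] HW[OF z' a'(2)] a(1) b a'(1) b'])
qed

section \<open>The resolvent of H\<close>

definition K :: "complex \<Rightarrow> 'h \<rightharpoonup> 'h" where
  "K \<mu> = adj (resolvent 1 (Gab (cnj \<mu>) \<circ>\<^sub>m adj I)) \<circ>\<^sub>m I \<circ>\<^sub>m Tab \<mu> \<circ>\<^sub>m adj I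
     \<circ>\<^sub>m resolvent 1 (Gab \<mu> \<circ>\<^sub>m adj I) \<circ>\<^sub>m resolvent \<mu> Lab"

text \<open>On the parametrization \<open>F = \<Gamma> R\<close> of the domain of \<open>H\<close>
  one has \<open>(z - H) F = X' (1 - K)\<close>. Since \<open>X'\<close> has the bounded inverse
  \<open>\<Gamma>'\<close> and \<open>F\<close> is injective, inverting \<open>z - H\<close> amounts
  to inverting \<open>1 - K\<close>. Boundedness of the latter inverse requires a separate estimate,
  because the inverse of \<open>F\<close> may be unbounded.\<close>

theorem H_resolvent:
  assumes z: "admissible z" and a: "a < 1" "rel_bounded a (V z) (S z)"
  shows "z \<in> \<rho> H \<longleftrightarrow> 1 \<in> \<rho> (K z)"
    and "z \<in> \<rho> H \<Longrightarrow> resolvent z H = resolvent 1 (Gab z \<circ>\<^sub>m adj I) \<circ>\<^sub>m resolvent z Lab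
      \<circ>\<^sub>m op_inv (Some -\<^sub>o K z) \<circ>\<^sub>m adj (resolvent 1 (Gab (cnj z) \<circ>\<^sub>m adj I))"
proof -
  note z' = admissible_cnj[OF z]
  define k where "k y = \<Gamma>' (cnj z) (v z y)" for y
  define F where "F y = \<Gamma> z (R z y)" for y
  have K: "K z = (\<lambda>y. Some (k y))"
  proof
    fix y
    have "V z (F y) = Some (v z y)"
      unfolding F_def by (rule V_\<Gamma>R[OF z a(2)])
    then show "K z y = Some (k y)"
      by (auto simp: K_def V_def F_def k_def map_comp_Some_iff R_eq[OF z] \<Gamma>_eq[OF z] adj_\<Gamma>_eq[OF z'])
  qed
  have HF: "H (F y) = Some (z *\<^sub>C F y - X' z (y - k y))" for y
    using H_\<Gamma>R_eq[OF z a(2), of y]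
    by (simp add: F_def k_def clinear_diff[OF X'_clinear[OF z]] X'_\<Gamma>'[OF z])
  have X'_inj: "X' z x = X' z y \<Longrightarrow> x = y" for x y
    using \<Gamma>'_X'[OF z] by metis
  have dom_F: "\<exists>y. f = F y" if "H f = Some u" for f u
    using dom_H[OF z a(2)] that unfolding F_def by blast
  have dense_H: "densely_defined H"
    using closure_\<Gamma>R[OF z] dom_H[OF z a(2)] by (simp add: densely_defined_def)
  have F: "cbounded F" "\<And>x y. F x = F y \<Longrightarrow> x = y"
    unfolding F_def
    by (rule cbounded_compose[OF \<Gamma>_cbounded[OF z] R_cbounded[OF z]], rule \<Gamma>R_inj[OF z])
  have K_to_H: "\<exists>s. (\<forall>y. s y - k (s y) = y) \<and> (\<forall>x. s (x - k x) = x) \<and> cbounded s \<and>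
      op_inv (Some -\<^sub>o K z) = (\<lambda>y. Some (s y))"
    if one: "1 \<in> \<rho> (K z)" and lin: "op_linear (K z)"
  proof -
    obtain s where s: "resolvent 1 (K z) = (\<lambda>y. Some (s y))" "\<And>y. K z (s y) = Some (1 *\<^sub>C s y - y)"
      "\<And>x u. K z x = Some u \<Longrightarrow> s (1 *\<^sub>C x - u) = x" "cbounded s"
      using resolvent_setE[OF one lin] by metis
    have "s y - k (s y) = y" for y
      using s(2)[of y] by (simp add: K)
    moreover have "s (x - k x) = x" for x
      using s(3)[of x] by (simp add: K)
    moreover from calculation have "op_inv (Some -\<^sub>o K z) = (\<lambda>y. Some (s y))"
      by (intro op_inv_eqI) (auto simp: K op_diff_Some_iff)
    ultimately show ?thesis using s(4) by blast
  qed
  have lin_K: "op_linear (K z)"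
    using clinear_compose[OF \<Gamma>'_clinear[OF z'] v_clinear[OF z a(2)]]
    by (simp add: K op_linear_total k_def[abs_def])
  have inv_to_H: "z \<in> \<rho> H \<and> resolvent z H = (\<lambda>y. Some (F (s (\<Gamma>' (cnj z) y))))"
    if s: "\<And>y. s y - k (s y) = y" "\<And>x. s (x - k x) = x" "cbounded s" for s
  proof -
    let ?r = "\<lambda>y. F (s (\<Gamma>' (cnj z) y))"
    have 1: "H (?r y) = Some (z *\<^sub>C ?r y - y)" for y
      by (simp add: HF s(1) X'_\<Gamma>'[OF z])
    have 2: "?r (z *\<^sub>C f - u) = f" if f: "H f = Some u" for f u
    proof -
      obtain y where y: "f = F y"
        using dom_F[OF f] by blast
      then have "u = z *\<^sub>C f - X' z (y - k y)"
        using f HF[of y] by simp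
      then have "z *\<^sub>C f - u = X' z (y - k y)" by simp
      then show ?thesis
        by (simp add: \<Gamma>'_X'[OF z] s(2) y)
    qed
    have "cbounded ?r"
      by (rule cbounded_compose[OF F(1) cbounded_compose[OF s(3) \<Gamma>'_cbounded[OF z']]])
    then show ?thesis
      using resolvent_setI[OF dense_H 1 2] resolvent_eqI[OF 1 2] by blast
  qed
  have H_to_K: "1 \<in> \<rho> (K z)" if zH: "z \<in> \<rho> H"
  proof -
    obtain q where q: "\<And>y. H (q y) = Some (z *\<^sub>C q y - y)" "\<And>f u. H f = Some u \<Longrightarrow> q (z *\<^sub>C f - u) = f"
      "cbounded q"
      using resolvent_setE[OF zH H_linear] by metis
    have "\<exists>x. q (X' z y) = F x" for y
      using dom_F[OF q(1)] .
    \<comment> \<open>The candidate for the inverse of \<open>1 - K\<close> is the inverse of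
      \<open>F\<close> applied to \<open>q X'\<close>.\<close>
    then obtain s where s: "\<And>y. q (X' z y) = F (s y)"
      by metis
    have "X' z (s y - k (s y)) = X' z y" for y
      using HF[of "s y"] q(1)[of "X' z y"] by (simp add: s)
    then have 1: "s y - k (s y) = y" for y
      by (rule X'_inj)
    have "F (s (x - k x)) = F x" for x
      using q(2)[OF HF[of x]] by (simp add: s)
    then have 2: "s (x - k x) = x" for x
      by (rule F(2))
    obtain b where b: "0 \<le> b" "\<And>y. norm (v z y) \<le> a * norm (X' z y) + b * norm (F y)"
      using v_bound[OF z a(2)] unfolding F_def by blast
    obtain C where C: "0 \<le> C" "\<And>y. norm (X' z y) \<le> C * norm y"
      using cboundedE[OF X'_cbounded[OF z]] by metis
    obtain D where D: "0 \<le> D" "\<And>y. norm (q y) \<le> D * norm y"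
      using cboundedE[OF q(3)] by metis
    obtain E where E: "0 \<le> E" "\<And>y. norm (\<Gamma>' (cnj z) y) \<le> E * norm y"
      using cboundedE[OF \<Gamma>'_cbounded[OF z']] by metis
    define A where "A = max 0 a"
    have A: "0 \<le> A" "A < 1" "a \<le> A"
      using a(1) by (auto simp: A_def)
    \<comment> \<open>The bound for \<open>v z (s y)\<close> relative to \<open>y\<close>: in
      \<open>X' s y = X' y + v (s y)\<close> the relative bound, being less than 1, absorbs the last
      term, and \<open>F (s y) = q (X' y)\<close> is controlled by the resolvent.\<close>
    define M where "M = (A * C + b * (D * C)) / (1 - A)"
    have bound: "norm (s y) \<le> (1 + E * M) * norm y" for y
    proof -
      have "X' z (s y) = X' z y + v z (s y)"
      proof -
        have "X' z (s y) = X' z (y + k (s y))"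
          using 1[of y] by (simp add: algebra_simps)
        then show ?thesis
          by (simp add: clinear_add[OF X'_clinear[OF z]] k_def X'_\<Gamma>'[OF z])
      qed
      then have "norm (X' z (s y)) \<le> C * norm y + norm (v z (s y))"
        using norm_triangle_ineq[of "X' z y" "v z (s y)"] C(2)[of y] by simp
      then have "A * norm (X' z (s y)) \<le> A * (C * norm y + norm (v z (s y)))"
        using A(1) by (rule mult_left_mono)
      moreover have "a * norm (X' z (s y)) \<le> A * norm (X' z (s y))"
        using A(3) by (intro mult_right_mono) auto
      moreover have "norm (F (s y)) \<le> D * (C * norm y)"
        using D(2)[of "X' z y"] mult_left_mono[OF C(2) D(1), of y] by (simp add: s)
      then have "b * norm (F (s y)) \<le> b * (D * (C * norm y))"
        using b(1) by (rule mult_left_mono)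
      ultimately have "norm (v z (s y)) \<le> A * (C * norm y + norm (v z (s y))) + b * (D * (C * norm y))"
        using b(2)[of "s y"] by linarith
      then have "norm (v z (s y)) * (1 - A) \<le> (A * C + b * (D * C)) * norm y"
        by (simp add: algebra_simps)
      then have "norm (v z (s y)) \<le> M * norm y"
        using A(2) by (simp add: M_def field_simps)
      then have "norm (k (s y)) \<le> E * (M * norm y)"
        using E(2)[of "v z (s y)"] mult_left_mono[OF _ E(1)] unfolding k_def by (meson order_trans)
      moreover have "norm (s y) \<le> norm y + norm (k (s y))"
        using norm_triangle_ineq[of y "k (s y)"] 1[of y] by (simp add: diff_eq_eq)
      ultimately show ?thesis
        by (simp add: algebra_simps)
    qed
    then have "cbounded s" by (rule cboundedI)
    then show ?thesis
      using 1 2 by (intro resolvent_setI[of "K z" s]) (auto simp: K densely_defined_total algebra_simps)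
  qed
  show iff: "z \<in> \<rho> H \<longleftrightarrow> 1 \<in> \<rho> (K z)"
    using H_to_K K_to_H[OF _ lin_K] inv_to_H by blast
  show "resolvent z H = resolvent 1 (Gab z \<circ>\<^sub>m adj I) \<circ>\<^sub>m resolvent z Lab
      \<circ>\<^sub>m op_inv (Some -\<^sub>o K z) \<circ>\<^sub>m adj (resolvent 1 (Gab (cnj z) \<circ>\<^sub>m adj I))" if zH: "z \<in> \<rho> H"
  proof -
    obtain s where s: "\<And>y. s y - k (s y) = y" "\<And>x. s (x - k x) = x" "cbounded s"
      "op_inv (Some -\<^sub>o K z) = (\<lambda>y. Some (s y))"
      using K_to_H[OF _ lin_K] zH iff by blast
    show ?thesis
      unfolding s(4) R_eq[OF z] \<Gamma>_eq[OF z] adj_\<Gamma>_eq[OF z']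
      using inv_to_H[OF s(1-3)] by (simp add: F_def map_comp_def)
  qed
qed

end

theorem theorem3p12:
  fixes Lm :: "'h::chilbert_space \<rightharpoonup> 'h"
    and Am :: "'h \<rightharpoonup> 'b::chilbert_space"
    and B :: "'h \<rightharpoonup> 'b"
    and I :: "'b \<rightharpoonup> 'h"
    and \<alpha> \<beta> \<gamma> \<delta> z :: complex
    and L H :: "'h \<rightharpoonup> 'h"
    and G :: "complex \<Rightarrow> 'b \<rightharpoonup> 'h"
    and T :: "complex \<Rightarrow> 'b \<rightharpoonup> 'b"
    and \<Gamma> :: "complex \<Rightarrow> 'h \<rightharpoonup> 'h"
    and K :: "'h \<rightharpoonup> 'h"
  defines "L \<equiv> L_ab Lm Am B \<alpha> \<beta>"
    and "H \<equiv> H_IBC Lm Am B I \<alpha> \<beta> \<gamma> \<delta>"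
    and "G \<equiv> G_ab Lm Am B \<alpha> \<beta> \<gamma> \<delta>"
    and "T \<equiv> T_ab Lm Am B \<alpha> \<beta> \<gamma> \<delta>"
    and "\<Gamma> \<equiv> \<lambda>\<mu>. resolvent 1 (G \<mu> \<circ>\<^sub>m adj I)"
    and "K \<equiv> adj (\<Gamma> (cnj z)) \<circ>\<^sub>m I \<circ>\<^sub>m T z \<circ>\<^sub>m adj I \<circ>\<^sub>m \<Gamma> z \<circ>\<^sub>m resolvent z L"
  assumes "ibc_setting Lm Am B I"
    and "cnj \<alpha> * \<gamma> \<in> \<real>"
    and "cnj \<beta> * \<delta> \<in> \<real>"
    and "\<beta> * cnj \<gamma> - cnj \<alpha> * \<delta> = 1"
    and "self_adjoint L"
    and "z \<in> \<rho> L \<inter> \<rho> (L_op Lm B)"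
    and "1 \<in> \<rho> (G z \<circ>\<^sub>m adj I) \<inter> \<rho> (G (cnj z) \<circ>\<^sub>m adj I)"
    and "\<forall>\<mu>\<in>{z, cnj z}. \<exists>a<1. rel_bounded a
           (I \<circ>\<^sub>m T \<mu> \<circ>\<^sub>m adj I)
           (adj (Some -\<^sub>o (G (cnj \<mu>) \<circ>\<^sub>m adj I)) \<circ>\<^sub>m (L -\<^sub>o \<mu> *\<^sub>o Some)
              \<circ>\<^sub>m (Some -\<^sub>o (G \<mu> \<circ>\<^sub>m adj I)))"
  shows "self_adjoint H \<and>
    (z \<in> \<rho> L \<inter> \<rho> H \<longleftrightarrow> 1 \<in> \<rho> K) \<and>
    (z \<in> \<rho> L \<inter> \<rho> H \<longrightarrow>
       resolvent z H =
         \<Gamma> z \<circ>\<^sub>m resolvent z L \<circ>\<^sub>m op_inv (Some -\<^sub>o K) \<circ>\<^sub>m adj (\<Gamma> (cnj z)))"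
proof -
  interpret M: ibc_robin Lm Am B I \<alpha> \<beta> \<gamma> \<delta>
    by (rule ibc_robin.intro[OF assms(7)
          ibc_robin_axioms.intro[OF assms(8-10) assms(11)[unfolded L_def]]])
  have z: "M.admissible z"
    using assms(12,13) unfolding M.admissible_def by (simp add: G_def L_def)
  have rel: "\<forall>\<mu>\<in>{z, cnj z}. \<exists>a<1. rel_bounded a (M.V \<mu>) (M.S \<mu>)"
    using assms(14) unfolding M.V_def M.S_def M.X_def G_def T_def L_def .
  obtain a where a: "a < 1" "rel_bounded a (M.V z) (M.S z)"
    using rel by blast
  obtain a' where a': "a' < 1" "rel_bounded a' (M.V (cnj z)) (M.S (cnj z))"
    using rel by blast
  have K: "K = M.K z"
    unfolding K_def \<Gamma>_def G_def T_def L_def M.K_def ..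
  show ?thesis
    using M.H_self_adjoint[OF z a a'] M.H_resolvent[OF z a] assms(12)
    unfolding K H_def \<Gamma>_def G_def L_def by blast
qed

end
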